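(* Let $E$ be an arbitrary graph and $K$ a field. Then $E$ satisfies Condition (K) if and only if every prime ideal of $L_K(E)$ is graded.
   Context: A graph $E=(E^0,E^1,r,s)$ consists of a set $E^0$ of vertices, a set $E^1$ of edges and maps $r,s:E^1\to E^0$ (range and source); no cardinality restrictions are imposed. A vertex $v$ is regular if $0<|s^{-1}(v)|<\infty$. The Leavitt path algebra $L_K(E)$ is the (not necessarily unital) $K$-algebra generated by pairwise orthogonal idempotents $v\in E^0$ and elements $e,e^*$ ($e\in E^1$) subject to: $s(e)e=e=er(e)$; $r(e)e^*=e^*=e^*s(e)$; $e^*e=r(e)$ and $e^*f=0$ for edges $e\ne f$; $v=\sum_{s(e)=v}ee^*$ for every regular vertex $v$. It is $\mathbb{Z}$-graded by $\deg v=0$, $\deg e=1$, $\deg e^*=-1$; a graded ideal is a homogeneous two-sided ideal. Ideals are two-sided; a proper ideal $P$ is prime if, for ideals $A,B$, $AB\subseteq P$ implies $A\subseteq P$ or $B\subseteq P$. A path is a finite sequence of edges $e_1\cdots e_n$ with $r(e_i)=s(e_{i+1})$. A closed simple path based at $v$ is a path $e_1\cdots e_n$ ($n\ge1$) with $s(e_1)=r(e_n)=v$ and $s(e_i)\neq v$ for $i>1$. $E$ satisfies Condition (K) if no vertex of $E$ is the base of precisely one closed simple path. *)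

theory Defs
  imports
    "HOL-Library.Poly_Mapping"
    "HOL-Algebra.Ideal_Product"
    "HOL-Algebra.QuotRing"
    "HOL-Algebra.Module"
    "Graph_Theory.Arc_Walk"
begin

section \<open>Graphs\<close>

text \<open>
  A graph \<open>(E\<^sup>0, E\<^sup>1, r, s)\<close> is a well-formed digraph with \<open>E\<^sup>0 = verts E\<close>, \<open>E\<^sup>1 = arcs E\<close>,
  \<open>r = head E\<close> and \<open>s = tail E\<close>; loops, parallel edges and infinite sets are allowed.
\<close>

definition regular_vertex :: "('v, 'e) pre_digraph \<Rightarrow> 'v \<Rightarrow> bool" where
  "regular_vertex E v \<longleftrightarrow> v \<in> verts E \<and> finite (out_arcs E v) \<and> out_arcs E v \<noteq> {}"

definition closed_simple_path :: "('v, 'e) pre_digraph \<Rightarrow> 'v \<Rightarrow> 'e list \<Rightarrow> bool" where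
  "closed_simple_path E v p \<longleftrightarrow>
     pre_digraph.awalk E v p v \<and> p \<noteq> [] \<and> (\<forall>e\<in>set (tl p). tail E e \<noteq> v)"

definition condition_K :: "('v, 'e) pre_digraph \<Rightarrow> bool" where
  "condition_K E \<longleftrightarrow> \<not> (\<exists>v\<in>verts E. \<exists>!p. closed_simple_path E v p)"


section \<open>Ideals of rings without unit\<close>

text \<open>
  The library locales for rings and ideals require a unit. Here the ring records are used for
  rings that need not have one; the field \<open>one\<close> is then irrelevant and is never referred to.
\<close>

definition two_sided_ideal :: "'a set \<Rightarrow> ('a, 'm) ring_scheme \<Rightarrow> bool" where
  "two_sided_ideal I R \<longleftrightarrow> additive_subgroup I R \<and>
     (\<forall>a\<in>I. \<forall>x\<in>carrier R. x \<otimes>\<^bsub>R\<^esub> a \<in> I \<and> a \<otimes>\<^bsub>R\<^esub> x \<in> I)"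

definition algebra_ideal :: "'a set \<Rightarrow> ('k, 'a, 'm) module_scheme \<Rightarrow> bool" where
  "algebra_ideal I A \<longleftrightarrow> two_sided_ideal I A \<and> (\<forall>k. \<forall>a\<in>I. k \<odot>\<^bsub>A\<^esub> a \<in> I)"

definition prime_two_sided_ideal :: "'a set \<Rightarrow> ('a, 'm) ring_scheme \<Rightarrow> bool" where
  "prime_two_sided_ideal P R \<longleftrightarrow> two_sided_ideal P R \<and> P \<noteq> carrier R \<and>
     (\<forall>A B. two_sided_ideal A R \<longrightarrow> two_sided_ideal B R \<longrightarrow> ideal_prod R A B \<subseteq> P
        \<longrightarrow> A \<subseteq> P \<or> B \<subseteq> P)"

text \<open>
  \<open>G n\<close> is the homogeneous component of degree \<open>n\<close>; the last conjunct says that \<open>I\<close> is the sum of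
  the \<open>I \<inter> G n\<close>.
\<close>

definition graded_ideal :: "(int \<Rightarrow> 'a set) \<Rightarrow> 'a set \<Rightarrow> ('a, 'm) ring_scheme \<Rightarrow> bool" where
  "graded_ideal G I R \<longleftrightarrow> two_sided_ideal I R \<and>
     (\<forall>x\<in>I. \<exists>S c. finite S \<and> (\<forall>n\<in>S. c n \<in> I \<inter> G n) \<and> x = (\<Oplus>\<^bsub>R\<^esub>n\<in>S. c n))"


section \<open>Free algebras without unit\<close>

text \<open>
  Words form a monoid, written additively because the convolution product on \<open>\<Rightarrow>\<^sub>0\<close> expects it.
\<close>

datatype 'g free_word = Word (letters: "'g list")

instantiation free_word :: (type) monoid_add
begin

definition "0 = Word []"
definition "u + v = Word (letters u @ letters v)"

instance
  by standard (simp_all add: zero_free_word_def plus_free_word_def)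

end

type_synonym ('g, 'k) free_poly = "'g free_word \<Rightarrow>\<^sub>0 'k"

definition gen :: "'g \<Rightarrow> ('g, 'k::field) free_poly" where
  "gen g = Poly_Mapping.single (Word [g]) 1"

definition free_algebra :: "'g set \<Rightarrow> ('k::field, ('g, 'k) free_poly) module" where
  "free_algebra X =
     \<lparr>carrier = {x. \<forall>w\<in>Poly_Mapping.keys x. letters w \<noteq> [] \<and> set (letters w) \<subseteq> X},
      mult = (*), one = undefined, zero = 0, add = (+),
      smult = (\<lambda>k x. Poly_Mapping.single 0 k * x)\<rparr>"


section \<open>Leavitt path algebras\<close>

datatype ('v, 'e) lpa_gen = Vertex 'v | Edge 'e | Ghost 'e

definition lpa_gens :: "('v, 'e) pre_digraph \<Rightarrow> ('v, 'e) lpa_gen set" where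
  "lpa_gens E = Vertex ` verts E \<union> Edge ` arcs E \<union> Ghost ` arcs E"

text \<open>Each relation \<open>l = r\<close> is recorded as the element \<open>l - r\<close> of the free algebra.\<close>

inductive_set lpa_relations ::
  "('v, 'e) pre_digraph \<Rightarrow> (('v, 'e) lpa_gen, 'k::field) free_poly set"
  for E :: "('v, 'e) pre_digraph"
where
  idempotent: "v \<in> verts E \<Longrightarrow>
    gen (Vertex v) * gen (Vertex v) - gen (Vertex v) \<in> lpa_relations E"
| orthogonal: "v \<in> verts E \<Longrightarrow> w \<in> verts E \<Longrightarrow> v \<noteq> w \<Longrightarrow>
    gen (Vertex v) * gen (Vertex w) \<in> lpa_relations E"
| source_edge: "e \<in> arcs E \<Longrightarrow>
    gen (Vertex (tail E e)) * gen (Edge e) - gen (Edge e) \<in> lpa_relations E"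
| edge_range: "e \<in> arcs E \<Longrightarrow>
    gen (Edge e) * gen (Vertex (head E e)) - gen (Edge e) \<in> lpa_relations E"
| range_ghost: "e \<in> arcs E \<Longrightarrow>
    gen (Vertex (head E e)) * gen (Ghost e) - gen (Ghost e) \<in> lpa_relations E"
| ghost_source: "e \<in> arcs E \<Longrightarrow>
    gen (Ghost e) * gen (Vertex (tail E e)) - gen (Ghost e) \<in> lpa_relations E"
| CK1_same: "e \<in> arcs E \<Longrightarrow>
    gen (Ghost e) * gen (Edge e) - gen (Vertex (head E e)) \<in> lpa_relations E"
| CK1_diff: "e \<in> arcs E \<Longrightarrow> f \<in> arcs E \<Longrightarrow> e \<noteq> f \<Longrightarrow>
    gen (Ghost e) * gen (Edge f) \<in> lpa_relations E"
| CK2: "regular_vertex E v \<Longrightarrow>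
    gen (Vertex v) - (\<Sum>e\<in>out_arcs E v. gen (Edge e) * gen (Ghost e)) \<in> lpa_relations E"

definition lpa_relation_ideal ::
  "('v, 'e) pre_digraph \<Rightarrow> (('v, 'e) lpa_gen, 'k::field) free_poly set" where
  "lpa_relation_ideal E =
     \<Inter> {I. algebra_ideal I (free_algebra (lpa_gens E)) \<and> lpa_relations E \<subseteq> I}"

definition lpa_class ::
  "('v, 'e) pre_digraph \<Rightarrow> (('v, 'e) lpa_gen, 'k::field) free_poly
     \<Rightarrow> (('v, 'e) lpa_gen, 'k) free_poly set" where
  "lpa_class E x = lpa_relation_ideal E +>\<^bsub>free_algebra (lpa_gens E)\<^esub> x"

text \<open>
  \<open>L\<^sub>K(E)\<close>, with the field \<open>K\<close> given as a type. The first five fields are those of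
  \<^const>\<open>FactRing\<close>, up to the irrelevant field \<open>one\<close>.
\<close>

definition leavitt_path_algebra ::
  "'k::field itself \<Rightarrow> ('v, 'e) pre_digraph
     \<Rightarrow> ('k, (('v, 'e) lpa_gen, 'k) free_poly set) module" where
  "leavitt_path_algebra K E =
     (let F = free_algebra (lpa_gens E); I = lpa_relation_ideal E in
       \<lparr>carrier = a_rcosets\<^bsub>F\<^esub> I, mult = rcoset_mult F I, one = undefined,
        zero = I, add = set_add F,
        smult = (\<lambda>k X. \<Union>x\<in>X. lpa_class E (k \<odot>\<^bsub>F\<^esub> x))\<rparr>)"

fun gen_degree :: "('v, 'e) lpa_gen \<Rightarrow> int" where
  "gen_degree (Vertex v) = 0"
| "gen_degree (Edge e) = 1"
| "gen_degree (Ghost e) = -1"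

definition word_degree :: "('v, 'e) lpa_gen free_word \<Rightarrow> int" where
  "word_degree w = (\<Sum>g\<leftarrow>letters w. gen_degree g)"

definition lpa_component ::
  "'k::field itself \<Rightarrow> ('v, 'e) pre_digraph \<Rightarrow> int
     \<Rightarrow> (('v, 'e) lpa_gen, 'k) free_poly set set" where
  "lpa_component K E n =
     {lpa_class E x | x. x \<in> carrier (free_algebra (lpa_gens E)) \<and>
                         (\<forall>w\<in>Poly_Mapping.keys x. word_degree w = n)}"

end

(*
  Condition (K) forces gradedness of every ideal P, prime or not. Let J be the largest graded ideal
  inside P. An element of P outside J can be multiplied into the form p z, still outside J, where p
  is a combination of paths and z is a vertex w, or w minus finitely many e e* and then a sink
  modulo J. Multiplying by the ghost of a shortest path of p leaves c z, with c a nonzero scalar, plus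
  multiples of longer closed paths at w. These vanish modulo J on multiplication by z if z is a sink.
  Otherwise, given two distinct closed simple paths g and h at w, they are killed by conjugation
  with g^m h for large m. So z lies in P, and being homogeneous it lies in J, a contradiction.

  Conversely, if c is the only closed simple path at v, the annihilator of the Chen module of
  infinite paths ending in ccc... is prime, as the module is simple; it contains c - v but not v.
*)

theory Submission
  imports Defs "HOL-Library.Stream"
begin

section \<open>Closed paths\<close>

text \<open>Working modulo J instead of P makes coefficients visible: in a graded ideal a
  combination of paths splits by length, and paths of equal length are separated by their ghosts.
  Modulo P terms of different length may cancel, as c and v do in the annihilator. The obstacle on
  the way to p z is a vertex w that is not regular, since no relation expresses w through its edges:
  an element may be killed by every edge and still survive multiplication by w. Subtracting e e* for
  the finitely many edges at w with which ghosts of the element begin removes those ghosts and does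
  not change the product with w modulo J; this is how z arises. It also replaces the passage to a
  quotient graph, on which Condition (K) would have to be checked anew. The exponent m in g^m h
  bounds the lengths of the closed paths to be killed: such a path consists of at most m closed
  simple paths, and comparing the first m + 1 of them on both sides sets g against h. All
  computations use representatives in the free algebra, so no basis of the Leavitt path algebra
  enters; that v survives is read off from its action on infinite paths.\<close>

context wf_digraph
begin

text \<open>Closed simple paths at one vertex form a prefix code: an edge following a complete one
  would leave \<open>v\<close> again, which is allowed for the first edge only.\<close>

lemma closed_simple_path_prefix_free:
  assumes "closed_simple_path G v g" "closed_simple_path G v h" "g @ r = h @ s"
  shows "g = h"
proof -
  have *: "t = []" if "closed_simple_path G v a" "closed_simple_path G v (a @ t)" for a t
  proof (cases t)
    case (Cons e t')
    have "awalk v a v" "a \<noteq> []" "awalk v (a @ t) v"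
      using that by (auto simp: closed_simple_path_def)
    then have "tail G e = v"
      using Cons by (auto simp: awalk_Cons_iff)
    moreover have "e \<in> set (tl (a @ t))"
      using \<open>a \<noteq> []\<close> Cons by simp
    ultimately show ?thesis
      using that(2) by (auto simp: closed_simple_path_def)
  qed
  from assms(3) obtain t where "g = h @ t \<or> h = g @ t"
    by (auto simp: append_eq_append_conv2)
  then show ?thesis
    using * assms(1,2) by fastforce
qed

text \<open>The cut is made at the first return to \<open>v\<close>, that is, before the first later
  edge with tail \<open>v\<close>.\<close>

lemma closed_walk_decomp:
  assumes "awalk v q v" "q \<noteq> []"
  obtains c r where "closed_simple_path G v c" "awalk v r v" "q = c @ r"
proof -
  obtain e q' where q: "q = e # q'"
    using assms(2) by (cases q) auto
  let ?P = "\<lambda>f. tail G f \<noteq> v"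
  define c r where "c = e # takeWhile ?P q'" and "r = dropWhile ?P q'"
  have qcr: "q = c @ r"
    by (simp add: q c_def r_def)
  have walk: "awalk v c (awlast v c)" "awalk (awlast v c) r v"
    using assms(1) unfolding qcr by simp_all
  have "awlast v c = v"
  proof (cases r)
    case Nil
    then show ?thesis using walk(2) by (simp add: awalk_Nil_iff)
  next
    case (Cons f r')
    have "tail G f = v"
      using Cons hd_dropWhile[of ?P q'] by (fastforce simp: r_def)
    then show ?thesis using walk(2) Cons by (simp add: awalk_Cons_iff)
  qed
  moreover have "\<forall>f\<in>set (tl c). tail G f \<noteq> v"
    by (auto simp: c_def dest: set_takeWhileD)
  ultimately show ?thesis
    using that[of c r] walk qcr by (auto simp: closed_simple_path_def c_def)
qed

lemma closed_walk_concat: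
  assumes "awalk v q v"
  obtains cs where "q = concat cs" "\<forall>c\<in>set cs. closed_simple_path G v c"
  using assms
proof (induction "length q" arbitrary: q thesis rule: less_induct)
  case less
  show ?case
  proof (cases "q = []")
    case True
    then show ?thesis using less.prems(1)[of "[]"] by simp
  next
    case False
    then obtain c r where c: "closed_simple_path G v c" "awalk v r v" "q = c @ r"
      using closed_walk_decomp less.prems(2) by metis
    then have "length r < length q"
      by (auto simp: closed_simple_path_def)
    then obtain cs where "r = concat cs" "\<forall>c\<in>set cs. closed_simple_path G v c"
      using less.hyps c(2) by metis
    then show ?thesis
      using less.prems(1)[of "c # cs"] c by simp
  qed
qed

text \<open>Unique decoding for the prefix code. The leftovers \<open>r\<close> and \<open>s\<close>
  are arbitrary, so two words can be compared on a common number of initial blocks.\<close>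

lemma concat_closed_simple_paths_inj:
  assumes "concat cs @ r = concat ds @ s" "length cs = length ds"
    "\<forall>c\<in>set cs. closed_simple_path G v c" "\<forall>d\<in>set ds. closed_simple_path G v d"
  shows "cs = ds"
  using assms(2,1,3,4)
proof (induction cs ds rule: list_induct2)
  case (Cons c cs d ds)
  then have "c = d"
    using closed_simple_path_prefix_free[of v c d "concat cs @ r" "concat ds @ s"] by simp
  then show ?case
    using Cons by simp
qed simp

text \<open>If \<open>\<gamma>\<close> were a prefix of \<open>q @ \<gamma>\<close>, both words
  would have the same first m + 1 blocks. In \<open>\<gamma>\<close> the last of these is
  \<open>h\<close>. In the other word \<open>q\<close> supplies at least one and at most m blocks,
  so the last of them is still a \<open>g\<close>.\<close>

lemma closed_simple_power_not_prefix:
  assumes g: "closed_simple_path G v g" and h: "closed_simple_path G v h" and "g \<noteq> h"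
    and q: "awalk v q v" "q \<noteq> []" "length q \<le> m"
  defines "\<gamma> \<equiv> concat (replicate m g) @ h"
  shows "q @ \<gamma> \<noteq> \<gamma> @ t"
proof
  assume eq: "q @ \<gamma> = \<gamma> @ t"
  obtain cs where cs: "q = concat cs" "\<forall>c\<in>set cs. closed_simple_path G v c"
    using closed_walk_concat[OF q(1)] .
  have pos: "0 < length cs"
    using cs(1) q(2) by auto
  have "\<forall>c\<in>set cs. 1 \<le> length c"
    using cs(2) by (auto simp: closed_simple_path_def Suc_le_eq)
  then have "sum_list (map (\<lambda>_. 1) cs) \<le> sum_list (map length cs)"
    by (intro sum_list_mono) auto
  then have len: "length cs \<le> m"
    using q(3) cs(1) by (simp add: length_concat sum_list_triv)
  \<comment> \<open>With \<open>Suc k\<close> copies of \<open>g\<close> the blocks of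
    \<open>q\<close> are completed to m + 1; the other \<open>length cs - 1\<close> copies and
    \<open>h\<close> go into the leftover.\<close>
  define k where "k = m - length cs"
  have "m = Suc k + (length cs - 1)"
    using pos len by (cases "length cs") (auto simp: k_def)
  then have "replicate m g = replicate (Suc k) g @ replicate (length cs - 1) g"
    by (metis replicate_add)
  then have "concat (cs @ replicate (Suc k) g) @ (concat (replicate (length cs - 1) g) @ h) =
        concat (replicate m g @ [h]) @ t"
    using eq cs(1) by (simp add: \<gamma>_def)
  moreover have "length (cs @ replicate (Suc k) g) = length (replicate m g @ [h])"
    using len by (simp add: k_def)
  ultimately have "cs @ replicate (Suc k) g = replicate m g @ [h]"
    by (rule concat_closed_simple_paths_inj[where v = v]) (use cs(2) g h in auto)
  then have "last (cs @ replicate (Suc k) g) = last (replicate m g @ [h])"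
    by simp
  then show False
    using \<open>g \<noteq> h\<close> by (simp del: replicate_Suc add: last_append last_replicate)
qed

lemma awalk_concat_replicate:
  "awalk v g v \<Longrightarrow> awalk v (concat (replicate m g)) v"
  by (induction m) (auto simp: awalk_Nil_iff)

end


section \<open>Free algebras\<close>

lemma letters_zero [simp]: "letters 0 = []"
  by (simp add: zero_free_word_def)

lemma letters_add [simp]: "letters (u + v) = letters u @ letters v"
  by (simp add: plus_free_word_def)

lemma zero_eq_Word: "0 = Word []"
  by (simp add: zero_free_word_def)

lemma Word_add_Word [simp]: "Word us + Word vs = Word (us @ vs)"
  by (simp add: plus_free_word_def)

lemma keys_minus_subset:
  fixes x y :: "'a \<Rightarrow>\<^sub>0 'b::ab_group_add"
  shows "Poly_Mapping.keys (x - y) \<subseteq> Poly_Mapping.keys x \<union> Poly_Mapping.keys y"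
  by (auto simp: in_keys_iff lookup_minus)

lemma poly_mapping_sum_single:
  fixes x :: "'a \<Rightarrow>\<^sub>0 'b::comm_monoid_add"
  shows "(\<Sum>w\<in>Poly_Mapping.keys x. Poly_Mapping.single w (Poly_Mapping.lookup x w)) = x"
  by (rule poly_mapping_eqI)
    (auto simp: lookup_sum lookup_single when_def in_keys_iff)

lemma poly_mapping_single_induct [consumes 1, case_names zero add single]:
  fixes x :: "'a \<Rightarrow>\<^sub>0 'b::comm_monoid_add"
  assumes "Poly_Mapping.keys x \<subseteq> W"
    and "P 0" "\<And>x y. P x \<Longrightarrow> P y \<Longrightarrow> P (x + y)"
    "\<And>w c. w \<in> W \<Longrightarrow> P (Poly_Mapping.single w c)"
  shows "P x"
proof -
  have "P (\<Sum>w\<in>A. Poly_Mapping.single w (Poly_Mapping.lookup x w))" if "finite A" "A \<subseteq> W" for A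
    using that by (induction A) (auto intro: assms)
  from this[OF finite_keys assms(1)] show ?thesis
    by (simp add: poly_mapping_sum_single)
qed

definition unital_free :: "'g set \<Rightarrow> ('g, 'k::field) free_poly set" where
  "unital_free X = {x. \<forall>w\<in>Poly_Mapping.keys x. set (letters w) \<subseteq> X}"

abbreviation nonunital_free :: "'g set \<Rightarrow> ('g, 'k::field) free_poly set" where
  "nonunital_free X \<equiv> carrier (free_algebra X)"

abbreviation scalar :: "'k \<Rightarrow> ('g, 'k::field) free_poly" where
  "scalar c \<equiv> Poly_Mapping.single 0 c"

definition mon :: "'g list \<Rightarrow> ('g, 'k::field) free_poly" where
  "mon ws = Poly_Mapping.single (Word ws) 1"

lemma gen_eq_mon: "gen g = mon [g]"
  by (simp add: gen_def mon_def)

lemma mon_Nil [simp]: "mon [] = 1"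
  by (simp add: mon_def flip: zero_eq_Word)

lemma mon_append: "mon (us @ vs) = mon us * mon vs"
  by (simp add: mon_def mult_single)

lemma mon_Cons: "mon (g # ws) = gen g * mon ws"
  by (simp add: gen_eq_mon flip: mon_append)

lemma single_eq_scalar_mon: "Poly_Mapping.single (Word ws) c = scalar c * mon ws"
  by (simp add: mon_def mult_single)

lemma scalar_commute: "scalar c * x = x * scalar c" for x :: "('g, 'k::field) free_poly"
proof -
  have "Poly_Mapping.keys x \<subseteq> UNIV"
    by simp
  then show ?thesis
    by (induction x rule: poly_mapping_single_induct)
      (simp_all add: mult_single distrib_left distrib_right mult.commute)
qed

lemma scalar_mult: "scalar a * scalar b = scalar (a * b)"
  by (simp add: mult_single)

lemma nonunital_free_iff:
  "x \<in> nonunital_free X \<longleftrightarrow> (\<forall>w\<in>Poly_Mapping.keys x. letters w \<noteq> [] \<and> set (letters w) \<subseteq> X)"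
  by (simp add: free_algebra_def)

lemma nonunital_imp_unital: "x \<in> nonunital_free X \<Longrightarrow> x \<in> unital_free X"
  by (simp add: nonunital_free_iff unital_free_def)

lemma unital_free_intros [simp, intro]:
  fixes x y :: "('g, 'k::field) free_poly"
  shows "0 \<in> unital_free X" "1 \<in> unital_free X" "scalar c \<in> unital_free X"
    "x \<in> unital_free X \<Longrightarrow> y \<in> unital_free X \<Longrightarrow> x + y \<in> unital_free X"
    "x \<in> unital_free X \<Longrightarrow> y \<in> unital_free X \<Longrightarrow> x - y \<in> unital_free X"
    "x \<in> unital_free X \<Longrightarrow> y \<in> unital_free X \<Longrightarrow> x * y \<in> unital_free X"
    "g \<in> X \<Longrightarrow> gen g \<in> unital_free X"
    "set ws \<subseteq> X \<Longrightarrow> mon ws \<in> unital_free X"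
  using keys_add[of x y] keys_minus_subset[of x y] keys_mult[of x y]
  by (fastforce simp: unital_free_def gen_def mon_def)+

lemma nonunital_free_intros [simp, intro]:
  fixes x y :: "('g, 'k::field) free_poly"
  shows "0 \<in> nonunital_free X"
    "x \<in> nonunital_free X \<Longrightarrow> y \<in> nonunital_free X \<Longrightarrow> x + y \<in> nonunital_free X"
    "x \<in> nonunital_free X \<Longrightarrow> y \<in> nonunital_free X \<Longrightarrow> x - y \<in> nonunital_free X"
    "x \<in> nonunital_free X \<Longrightarrow> - x \<in> nonunital_free X"
    "x \<in> nonunital_free X \<Longrightarrow> y \<in> unital_free X \<Longrightarrow> x * y \<in> nonunital_free X"
    "x \<in> unital_free X \<Longrightarrow> y \<in> nonunital_free X \<Longrightarrow> x * y \<in> nonunital_free X"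
    "g \<in> X \<Longrightarrow> gen g \<in> nonunital_free X"
    "set ws \<subseteq> X \<Longrightarrow> ws \<noteq> [] \<Longrightarrow> mon ws \<in> nonunital_free X"
  using keys_add[of x y] keys_minus_subset[of x y] keys_minus_subset[of 0 x] keys_mult[of x y]
  by (fastforce simp: nonunital_free_iff unital_free_def gen_def mon_def)+

lemma nonunital_free_sum [simp, intro]:
  "(\<And>a. a \<in> A \<Longrightarrow> f a \<in> nonunital_free X) \<Longrightarrow> sum f A \<in> nonunital_free X"
  by (induction A rule: infinite_finite_induct) auto

lemma unital_free_induct [consumes 1, case_names zero add mon]:
  assumes "x \<in> unital_free X"
    and "P 0" "\<And>x y. P x \<Longrightarrow> P y \<Longrightarrow> P (x + y)"
    and mon: "\<And>ws c. set ws \<subseteq> X \<Longrightarrow> P (scalar c * mon ws)"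
  shows "P x"
proof -
  have "Poly_Mapping.keys x \<subseteq> {w. set (letters w) \<subseteq> X}"
    using assms(1) by (auto simp: unital_free_def)
  then show ?thesis
  proof (induction x rule: poly_mapping_single_induct)
    case (single w c)
    then show ?case using mon[of "letters w" c] by (simp flip: single_eq_scalar_mon)
  qed (auto intro: assms)
qed

lemma nonunital_free_induct [consumes 1, case_names zero add mon]:
  assumes "x \<in> nonunital_free X"
    and "P 0" "\<And>x y. P x \<Longrightarrow> P y \<Longrightarrow> P (x + y)"
    and mon: "\<And>ws c. set ws \<subseteq> X \<Longrightarrow> ws \<noteq> [] \<Longrightarrow> P (scalar c * mon ws)"
  shows "P x"
proof -
  have "Poly_Mapping.keys x \<subseteq> {w. letters w \<noteq> [] \<and> set (letters w) \<subseteq> X}"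
    using assms(1) by (auto simp: nonunital_free_iff)
  then show ?thesis
  proof (induction x rule: poly_mapping_single_induct)
    case (single w c)
    then show ?case using mon[of "letters w" c] by (simp flip: single_eq_scalar_mon)
  qed (auto intro: assms)
qed


section \<open>Homogeneous components\<close>

definition hcomp :: "int \<Rightarrow> (('v, 'e) lpa_gen, 'k::field) free_poly \<Rightarrow> (('v, 'e) lpa_gen, 'k) free_poly"
  where "hcomp n x =
    (\<Sum>w\<in>{w\<in>Poly_Mapping.keys x. word_degree w = n}. Poly_Mapping.single w (Poly_Mapping.lookup x w))"

lemma lookup_hcomp:
  "Poly_Mapping.lookup (hcomp n x) w = (if word_degree w = n then Poly_Mapping.lookup x w else 0)"
  by (auto simp: hcomp_def lookup_sum lookup_single when_def in_keys_iff)

lemma hcomp_0 [simp]: "hcomp n 0 = 0"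
  and hcomp_add: "hcomp n (x + y) = hcomp n x + hcomp n y"
  and hcomp_diff: "hcomp n (x - y) = hcomp n x - hcomp n y"
  by (rule poly_mapping_eqI; simp add: lookup_hcomp lookup_add lookup_minus)+

lemma hcomp_sum: "hcomp n (sum f A) = (\<Sum>a\<in>A. hcomp n (f a))"
  by (induction A rule: infinite_finite_induct) (simp_all add: hcomp_add)

lemma hcomp_single:
  "hcomp n (Poly_Mapping.single w c) = (if word_degree w = n then Poly_Mapping.single w c else 0)"
  by (rule poly_mapping_eqI) (auto simp: lookup_hcomp lookup_single when_def)

lemma word_degree_zero [simp]: "word_degree 0 = 0"
  and word_degree_add: "word_degree (u + v) = word_degree u + word_degree v"
  by (simp_all add: word_degree_def)

lemma hcomp_single_mult:
  "hcomp n (Poly_Mapping.single u c * x) = Poly_Mapping.single u c * hcomp (n - word_degree u) x"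
proof -
  have "Poly_Mapping.keys x \<subseteq> UNIV"
    by simp
  then show ?thesis
    by (induction x rule: poly_mapping_single_induct)
      (auto simp: mult_single distrib_left hcomp_add hcomp_single word_degree_add)
qed

lemma hcomp_mult_single:
  "hcomp n (x * Poly_Mapping.single u c) = hcomp (n - word_degree u) x * Poly_Mapping.single u c"
proof -
  have "Poly_Mapping.keys x \<subseteq> UNIV"
    by simp
  then show ?thesis
    by (induction x rule: poly_mapping_single_induct)
      (auto simp: mult_single distrib_right hcomp_add hcomp_single word_degree_add)
qed

lemma sum_hcomp: "(\<Sum>n\<in>word_degree ` Poly_Mapping.keys x. hcomp n x) = x"
  by (rule poly_mapping_eqI)
    (auto simp: lookup_sum lookup_hcomp sum.If_cases in_keys_iff Int_insert_right sum.delta')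

definition homogeneous :: "int \<Rightarrow> (('v, 'e) lpa_gen, 'k::field) free_poly \<Rightarrow> bool" where
  "homogeneous n x \<longleftrightarrow> (\<forall>w\<in>Poly_Mapping.keys x. word_degree w = n)"

lemma hcomp_homogeneous: "homogeneous n x \<Longrightarrow> hcomp m x = (if m = n then x else 0)"
  by (rule poly_mapping_eqI) (auto simp: lookup_hcomp homogeneous_def in_keys_iff)

lemma homogeneous_hcomp: "homogeneous n (hcomp n x)"
  by (auto simp: homogeneous_def in_keys_iff lookup_hcomp split: if_splits)

lemma homogeneous_add: "homogeneous n x \<Longrightarrow> homogeneous n y \<Longrightarrow> homogeneous n (x + y)"
  using keys_add[of x y] by (force simp: homogeneous_def)

lemma homogeneous_diff: "homogeneous n x \<Longrightarrow> homogeneous n y \<Longrightarrow> homogeneous n (x - y)"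
  using keys_minus_subset[of x y] by (force simp: homogeneous_def)

lemma homogeneous_mult: "homogeneous m x \<Longrightarrow> homogeneous n y \<Longrightarrow> homogeneous (m + n) (x * y)"
  using keys_mult[of x y] by (force simp: homogeneous_def word_degree_add)

lemma homogeneous_sum: "(\<And>a. a \<in> A \<Longrightarrow> homogeneous n (f a)) \<Longrightarrow> homogeneous n (sum f A)"
  by (induction A rule: infinite_finite_induct) (simp_all add: homogeneous_add, simp_all add: homogeneous_def)

lemma homogeneous_scalar: "homogeneous 0 (scalar c)"
  by (simp add: homogeneous_def)

lemma homogeneous_gen: "homogeneous (gen_degree g) (gen g)"
  by (simp add: homogeneous_def gen_def word_degree_def)

lemma homogeneous_mon: "homogeneous (\<Sum>g\<leftarrow>ws. gen_degree g) (mon ws)"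
  by (simp add: homogeneous_def mon_def word_degree_def)

lemma homogeneous_gen_mult_gen:
  "gen_degree g + gen_degree h = n \<Longrightarrow> homogeneous n (gen g * gen h)"
  using homogeneous_mult[OF homogeneous_gen homogeneous_gen] by blast

lemma homogeneous_gen': "gen_degree g = n \<Longrightarrow> homogeneous n (gen g)"
  using homogeneous_gen by blast

text \<open>This is the source of the grading: it puts the relations into the graded part of every
  ideal that contains them.\<close>

lemma homogeneous_lpa_relation: "x \<in> lpa_relations E \<Longrightarrow> \<exists>n. homogeneous n x"
  by (induction rule: lpa_relations.induct)
    (rule exI, (intro homogeneous_diff homogeneous_sum)?;
      rule homogeneous_gen_mult_gen homogeneous_gen'; force)+


section \<open>Ideals of free algebras\<close>

text \<open>
  In an algebra with local units every ring ideal is stable under scalars; on the level of free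
  algebras this is part of the definition, in the form of stability under the unital algebra.
\<close>

locale free_ideal =
  fixes X :: "'g set" and P :: "('g, 'k::field) free_poly set"
  assumes subset: "P \<subseteq> nonunital_free X"
    and zero_mem [simp, intro]: "0 \<in> P"
    and add_mem: "x \<in> P \<Longrightarrow> y \<in> P \<Longrightarrow> x + y \<in> P"
    and left_mem: "x \<in> P \<Longrightarrow> a \<in> unital_free X \<Longrightarrow> a * x \<in> P"
    and right_mem: "x \<in> P \<Longrightarrow> a \<in> unital_free X \<Longrightarrow> x * a \<in> P"
begin

lemma uminus_mem: "x \<in> P \<Longrightarrow> - x \<in> P"
  using left_mem[OF _ unital_free_intros(3), of x "-1"] by (simp add: single_uminus)

lemma diff_mem: "x \<in> P \<Longrightarrow> y \<in> P \<Longrightarrow> x - y \<in> P"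
  using add_mem[OF _ uminus_mem] by fastforce

lemma sum_mem: "(\<And>a. a \<in> A \<Longrightarrow> f a \<in> P) \<Longrightarrow> sum f A \<in> P"
  by (induction A rule: infinite_finite_induct) (auto intro: add_mem)

lemma unscale_mem: "scalar c * x \<in> P \<Longrightarrow> c \<noteq> 0 \<Longrightarrow> x \<in> P"
  using left_mem[of "scalar c * x" "scalar (inverse c)"]
  by (simp add: scalar_mult flip: mult.assoc)

text \<open>Computations stay in the free algebra. The same elements are read modulo the relation
  ideal, a given ideal or its graded part by changing \<open>P\<close> alone.\<close>

definition cong (infix \<open>\<approx>\<close> 50) where
  "x \<approx> y \<longleftrightarrow> x - y \<in> P"

lemma cong_refl [simp, intro]: "x \<approx> x"
  by (simp add: cong_def)

lemma cong_sym: "x \<approx> y \<Longrightarrow> y \<approx> x"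
  using uminus_mem[of "x - y"] by (simp add: cong_def)

lemma cong_trans [trans]: "x \<approx> y \<Longrightarrow> y \<approx> z \<Longrightarrow> x \<approx> z"
  using add_mem[of "x - y" "y - z"] by (simp add: cong_def)

lemma cong_0_iff [simp]: "x \<approx> 0 \<longleftrightarrow> x \<in> P"
  by (simp add: cong_def)

lemma cong_mem_iff: "x \<approx> y \<Longrightarrow> x \<in> P \<longleftrightarrow> y \<in> P"
  using cong_trans cong_sym by (metis cong_0_iff)

lemma cong_add: "x \<approx> x' \<Longrightarrow> y \<approx> y' \<Longrightarrow> x + y \<approx> x' + y'"
  using add_mem[of "x - x'" "y - y'"] by (simp add: cong_def algebra_simps)

lemma cong_diff: "x \<approx> x' \<Longrightarrow> y \<approx> y' \<Longrightarrow> x - y \<approx> x' - y'"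
  using diff_mem[of "x - x'" "y - y'"] by (simp add: cong_def algebra_simps)

lemma cong_sum: "(\<And>a. a \<in> A \<Longrightarrow> f a \<approx> g a) \<Longrightarrow> sum f A \<approx> sum g A"
  by (induction A rule: infinite_finite_induct) (auto intro: cong_add)

lemma cong_left: "x \<approx> y \<Longrightarrow> a \<in> unital_free X \<Longrightarrow> a * x \<approx> a * y"
  using left_mem[of "x - y" a] by (simp add: cong_def algebra_simps)

lemma cong_right: "x \<approx> y \<Longrightarrow> a \<in> unital_free X \<Longrightarrow> x * a \<approx> y * a"
  using right_mem[of "x - y" a] by (simp add: cong_def algebra_simps)

lemma cong_mid: "x \<approx> y \<Longrightarrow> a \<in> unital_free X \<Longrightarrow> b \<in> unital_free X \<Longrightarrow> a * x * b \<approx> a * y * b"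
  by (intro cong_left cong_right)

end

text \<open>Generators suffice because the unital algebra is spanned by words, and a word acts one
  letter at a time; scalars are central and can be pulled to the left.\<close>

lemma free_idealI:
  fixes P :: "('g, 'k::field) free_poly set"
  assumes "P \<subseteq> nonunital_free X" "0 \<in> P" "\<And>x y. x \<in> P \<Longrightarrow> y \<in> P \<Longrightarrow> x + y \<in> P"
    and "\<And>x c. x \<in> P \<Longrightarrow> scalar c * x \<in> P"
    and "\<And>x g. x \<in> P \<Longrightarrow> g \<in> X \<Longrightarrow> gen g * x \<in> P"
    and "\<And>x g. x \<in> P \<Longrightarrow> g \<in> X \<Longrightarrow> x * gen g \<in> P"
  shows "free_ideal X P"
proof
  have l: "mon ws * x \<in> P" if "x \<in> P" "set ws \<subseteq> X" for x ws
    using that by (induction ws) (auto intro: assms simp: mon_Cons mult.assoc)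
  have r: "x * mon ws \<in> P" if "x \<in> P" "set ws \<subseteq> X" for x ws
    using that by (induction ws arbitrary: x) (auto intro: assms simp: mon_Cons simp flip: mult.assoc)
  fix x a :: "('g, 'k) free_poly" assume x: "x \<in> P" and a: "a \<in> unital_free X"
  show "a * x \<in> P"
    using a by (induction a rule: unital_free_induct)
      (auto simp: distrib_right mult.assoc intro: assms l x)
  have "x * (scalar c * y) = scalar c * (x * y)" for c and y :: "('g, 'k) free_poly"
    by (metis mult.assoc scalar_commute)
  note comm = this
  show "x * a \<in> P"
    using a by (induction a rule: unital_free_induct) (auto simp: distrib_left comm intro: assms r x)
qed (use assms in auto)


section \<open>Computing modulo the Leavitt relations\<close>

abbreviation vx :: "'v \<Rightarrow> (('v, 'e) lpa_gen, 'k::field) free_poly" where "vx v \<equiv> gen (Vertex v)"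
abbreviation ed :: "'e \<Rightarrow> (('v, 'e) lpa_gen, 'k::field) free_poly" where "ed e \<equiv> gen (Edge e)"
abbreviation gh :: "'e \<Rightarrow> (('v, 'e) lpa_gen, 'k::field) free_poly" where "gh e \<equiv> gen (Ghost e)"

definition path :: "'e list \<Rightarrow> (('v, 'e) lpa_gen, 'k::field) free_poly" where
  "path \<alpha> = mon (map Edge \<alpha>)"

definition ghost_path :: "'e list \<Rightarrow> (('v, 'e) lpa_gen, 'k::field) free_poly" where
  "ghost_path \<alpha> = mon (map Ghost (rev \<alpha>))"

lemma path_Nil [simp]: "path [] = 1" and ghost_path_Nil [simp]: "ghost_path [] = 1"
  by (simp_all add: path_def ghost_path_def)

lemma path_Cons: "path (e # \<alpha>) = ed e * path \<alpha>"
  by (simp add: path_def mon_Cons)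

lemma path_append: "path (\<alpha> @ \<beta>) = path \<alpha> * path \<beta>"
  by (simp add: path_def mon_append)

lemma ghost_path_Cons: "ghost_path (e # \<alpha>) = ghost_path \<alpha> * gh e"
  by (simp add: ghost_path_def mon_append gen_eq_mon)

lemma homogeneous_path: "homogeneous (int (length \<alpha>)) (path \<alpha>)"
  using homogeneous_mon[of "map Edge \<alpha>"] by (simp add: path_def comp_def sum_list_triv)

text \<open>An ideal of the Leavitt path algebra, pulled back to the free algebra. \<open>P\<close>
  may be improper, and it may be the relation ideal itself.\<close>

locale lpa_ideal = wf_digraph E + free_ideal "lpa_gens E" P
  for E :: "('v, 'e) pre_digraph" and P :: "(('v, 'e) lpa_gen, 'k::field) free_poly set" +
  assumes relations: "lpa_relations E \<subseteq> P"
begin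

abbreviation "F1 \<equiv> unital_free (lpa_gens E)"
abbreviation "F0 \<equiv> nonunital_free (lpa_gens E)"

lemma lpa_gens_iff [simp]:
  "Vertex v \<in> lpa_gens E \<longleftrightarrow> v \<in> verts E"
  "Edge e \<in> lpa_gens E \<longleftrightarrow> e \<in> arcs E"
  "Ghost e \<in> lpa_gens E \<longleftrightarrow> e \<in> arcs E"
  by (auto simp: lpa_gens_def)

lemma path_unital_free [simp, intro]:
  "set \<alpha> \<subseteq> arcs E \<Longrightarrow> path \<alpha> \<in> F1" "set \<alpha> \<subseteq> arcs E \<Longrightarrow> ghost_path \<alpha> \<in> F1"
  unfolding path_def ghost_path_def by (rule unital_free_intros(8); auto)+

lemma gen_cong:
  "v \<in> verts E \<Longrightarrow> w \<in> verts E \<Longrightarrow> vx v * vx w \<approx> (if v = w then vx v else 0)"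
  "e \<in> arcs E \<Longrightarrow> vx (tail E e) * ed e \<approx> ed e"
  "e \<in> arcs E \<Longrightarrow> ed e * vx (head E e) \<approx> ed e"
  "e \<in> arcs E \<Longrightarrow> vx (head E e) * gh e \<approx> gh e"
  "e \<in> arcs E \<Longrightarrow> gh e * vx (tail E e) \<approx> gh e"
  "e \<in> arcs E \<Longrightarrow> f \<in> arcs E \<Longrightarrow> gh e * ed f \<approx> (if e = f then vx (head E e) else 0)"
  using relations by (auto simp: cong_def intro: lpa_relations.intros)

lemma vx_idem: "v \<in> verts E \<Longrightarrow> vx v * vx v \<approx> vx v"
  using gen_cong(1)[of v v] by simp

lemma vx_ed:
  assumes "v \<in> verts E" "e \<in> arcs E"
  shows "vx v * ed e \<approx> (if v = tail E e then ed e else 0)"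
proof -
  have "vx v * ed e \<approx> vx v * (vx (tail E e) * ed e)"
    using gen_cong(2) assms by (blast intro: cong_left cong_sym unital_free_intros lpa_gens_iff[THEN iffD2])
  also have "\<dots> = (vx v * vx (tail E e)) * ed e"
    by (simp add: mult.assoc)
  also have "\<dots> \<approx> (if v = tail E e then vx v else 0) * ed e"
    using assms by (intro cong_right gen_cong) auto
  also have "\<dots> \<approx> (if v = tail E e then ed e else 0)"
    using gen_cong(2) assms by auto
  finally show ?thesis .
qed

lemma ed_vx:
  assumes "v \<in> verts E" "e \<in> arcs E"
  shows "ed e * vx v \<approx> (if v = head E e then ed e else 0)"
proof -
  have "ed e * vx v \<approx> (ed e * vx (head E e)) * vx v"
    using gen_cong(3) assms by (blast intro: cong_right cong_sym unital_free_intros lpa_gens_iff[THEN iffD2])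
  also have "\<dots> = ed e * (vx (head E e) * vx v)"
    by (simp add: mult.assoc)
  also have "\<dots> \<approx> ed e * (if head E e = v then vx (head E e) else 0)"
    using assms by (intro cong_left gen_cong) auto
  also have "\<dots> \<approx> (if v = head E e then ed e else 0)"
    using gen_cong(3) assms by auto
  finally show ?thesis .
qed

lemma gh_vx:
  assumes "v \<in> verts E" "e \<in> arcs E"
  shows "gh e * vx v \<approx> (if v = tail E e then gh e else 0)"
proof -
  have "gh e * vx v \<approx> (gh e * vx (tail E e)) * vx v"
    using gen_cong(5) assms by (blast intro: cong_right cong_sym unital_free_intros lpa_gens_iff[THEN iffD2])
  also have "\<dots> = gh e * (vx (tail E e) * vx v)"
    by (simp add: mult.assoc)
  also have "\<dots> \<approx> gh e * (if tail E e = v then vx (tail E e) else 0)"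
    using assms by (intro cong_left gen_cong) auto
  also have "\<dots> \<approx> (if v = tail E e then gh e else 0)"
    using gen_cong(5) assms by auto
  finally show ?thesis .
qed

text \<open>The trailing \<open>vx w\<close> makes this true for the empty path as well, where
  \<open>path []\<close> is the unit \<open>1\<close> and not a vertex.\<close>

lemma vx_path:
  assumes "awalk u \<alpha> w"
  shows "vx u * path \<alpha> * vx w \<approx> path \<alpha> * vx w"
proof (cases \<alpha>)
  case Nil
  then show ?thesis using assms by (auto simp: awalk_Nil_iff intro: vx_idem)
next
  case (Cons e \<beta>)
  then have e: "e \<in> arcs E" "u = tail E e" "set \<beta> \<subseteq> arcs E" "w \<in> verts E"
    using assms by (auto simp: awalk_Cons_iff)
  have "(vx u * ed e) * (path \<beta> * vx w) \<approx> ed e * (path \<beta> * vx w)"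
    using e gen_cong(2) by (intro cong_right) auto
  then show ?thesis
    by (simp add: Cons path_Cons mult.assoc)
qed

lemma ghost_path_vx:
  assumes "awalk u \<alpha> w"
  shows "vx w * ghost_path \<alpha> * vx u \<approx> vx w * ghost_path \<alpha>"
proof (cases \<alpha>)
  case Nil
  then show ?thesis using assms by (auto simp: awalk_Nil_iff intro: vx_idem)
next
  case (Cons e \<beta>)
  then have e: "e \<in> arcs E" "u = tail E e" "set \<beta> \<subseteq> arcs E" "w \<in> verts E"
    using assms by (auto simp: awalk_Cons_iff)
  have "(vx w * ghost_path \<beta>) * (gh e * vx u) \<approx> (vx w * ghost_path \<beta>) * gh e"
    using e gen_cong(5) by (intro cong_left) auto
  then show ?thesis
    by (simp add: Cons ghost_path_Cons mult.assoc)
qed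

lemma ghost_path_path:
  assumes "awalk u \<alpha> w"
  shows "vx w * ghost_path \<alpha> * path \<alpha> \<approx> vx w"
  using assms
proof (induction \<alpha> arbitrary: u)
  case (Cons e \<alpha>)
  then have e: "e \<in> arcs E" "u = tail E e" "awalk (head E e) \<alpha> w" "set \<alpha> \<subseteq> arcs E" "w \<in> verts E"
    by (auto simp: awalk_Cons_iff)
  have "vx w * ghost_path (e # \<alpha>) * path (e # \<alpha>) = (vx w * ghost_path \<alpha>) * (gh e * ed e) * path \<alpha>"
    by (simp add: path_Cons ghost_path_Cons mult.assoc)
  also have "\<dots> \<approx> (vx w * ghost_path \<alpha>) * vx (head E e) * path \<alpha>"
    using e gen_cong(6)[of e e] by (intro cong_mid) auto
  also have "\<dots> \<approx> (vx w * ghost_path \<alpha>) * path \<alpha>"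
    using ghost_path_vx[OF e(3)] e(4) by (intro cong_right) auto
  also have "\<dots> \<approx> vx w"
    using Cons.IH[OF e(3)] .
  finally show ?case .
qed simp

text \<open>Equal first edges are peeled off both words until two distinct edges meet, which must
  happen because \<open>\<alpha>\<close> is neither a prefix of \<open>\<beta>\<close> nor longer.
  The words need not be walks: a vertex left over between edges that do not fit together kills the
  product as well.\<close>

lemma ghost_path_path_diff:
  assumes "set \<alpha> \<subseteq> arcs E" "set \<beta> \<subseteq> arcs E" "length \<alpha> \<le> length \<beta>" "\<And>\<delta>. \<beta> \<noteq> \<alpha> @ \<delta>"
  shows "ghost_path \<alpha> * path \<beta> \<in> P"
  using assms
proof (induction \<alpha> arbitrary: \<beta>)
  case (Cons e \<alpha>)
  then obtain f \<beta>' where \<beta>: "\<beta> = f # \<beta>'"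
    by (cases \<beta>) auto
  have arcs: "e \<in> arcs E" "f \<in> arcs E" "set \<alpha> \<subseteq> arcs E" "set \<beta>' \<subseteq> arcs E"
    using Cons.prems \<beta> by auto
  have eq: "ghost_path (e # \<alpha>) * path \<beta> = ghost_path \<alpha> * (gh e * ed f) * path \<beta>'"
    by (simp add: \<beta> path_Cons ghost_path_Cons mult.assoc)
  show ?case
  proof (cases "e = f")
    case False
    then have "gh e * ed f \<in> P"
      using gen_cong(6)[of e f] arcs by simp
    then show ?thesis
      unfolding eq using arcs by (intro right_mem[OF left_mem]) auto
  next
    case True
    then have nopre: "\<And>\<delta>. \<beta>' \<noteq> \<alpha> @ \<delta>" and len: "length \<alpha> \<le> length \<beta>'"
      using Cons.prems \<beta> by auto
    then have IH: "ghost_path \<alpha> * path \<beta>' \<in> P"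
      using Cons.IH arcs by auto
    obtain g \<beta>'' where \<beta>': "\<beta>' = g # \<beta>''"
      using len nopre by (cases \<beta>') auto
    have "vx (head E e) * path \<beta>' \<approx> (if head E e = tail E g then ed g else 0) * path \<beta>''"
      unfolding \<beta>' path_Cons mult.assoc[symmetric]
      using arcs \<beta>' vx_ed[of "head E e" g] by (intro cong_right) auto
    then have "ghost_path \<alpha> * (vx (head E e) * path \<beta>') \<approx>
        ghost_path \<alpha> * ((if head E e = tail E g then ed g else 0) * path \<beta>'')"
      using arcs by (intro cong_left) auto
    moreover have "ghost_path \<alpha> * ((if head E e = tail E g then ed g else 0) * path \<beta>'') \<in> P"
      using IH by (auto simp: \<beta>' path_Cons)
    ultimately have "ghost_path \<alpha> * vx (head E e) * path \<beta>' \<in> P"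
      using cong_mem_iff by (simp add: mult.assoc)
    moreover have "ghost_path \<alpha> * (gh e * ed f) * path \<beta>' \<approx> ghost_path \<alpha> * vx (head E e) * path \<beta>'"
      using True arcs gen_cong(6)[of e f] by (intro cong_mid) auto
    ultimately show ?thesis
      unfolding eq using cong_mem_iff by blast
  qed
qed (metis append_Nil)

lemma not_awalk_imp_mem:
  assumes "set \<alpha> \<subseteq> arcs E" "u \<in> verts E" "w \<in> verts E" "\<not> awalk u \<alpha> w"
  shows "vx u * path \<alpha> * vx w \<in> P"
  using assms
proof (induction \<alpha> arbitrary: u)
  case Nil
  then show ?case
    using gen_cong(1)[of u w] by (auto simp: awalk_Nil_iff)
next
  case (Cons e \<alpha>)
  then have e: "e \<in> arcs E" "set \<alpha> \<subseteq> arcs E" "head E e \<in> verts E"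
    by auto
  have "vx u * path (e # \<alpha>) * vx w = (vx u * ed e) * (path \<alpha> * vx w)"
    by (simp add: path_Cons mult.assoc)
  also have "\<dots> \<approx> (if u = tail E e then ed e else 0) * (path \<alpha> * vx w)"
    using e Cons.prems by (intro cong_right vx_ed) auto
  also have "\<dots> \<approx> 0"
  proof (cases "u = tail E e")
    case True
    then have IH: "vx (head E e) * path \<alpha> * vx w \<in> P"
      using Cons e by (auto simp: awalk_Cons_iff)
    have "ed e * (path \<alpha> * vx w) \<approx> (ed e * vx (head E e)) * (path \<alpha> * vx w)"
      using e Cons.prems gen_cong(3) by (intro cong_right) (auto intro: cong_sym)
    also have "\<dots> = ed e * (vx (head E e) * path \<alpha> * vx w)"
      by (simp add: mult.assoc)
    also have "\<dots> \<approx> 0"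
      using IH e by (auto intro: left_mem)
    finally show ?thesis
      using True by simp
  qed simp
  finally show ?case
    by simp
qed

text \<open>Words that are not walks vanish modulo \<open>P\<close>; hence every term that survives
  is carried by a genuine walk into \<open>w\<close>.\<close>

lemma path_vx_not_mem_imp_awalk:
  assumes "set \<alpha> \<subseteq> arcs E" "w \<in> verts E" "path \<alpha> * vx w \<notin> P"
  obtains u where "awalk u \<alpha> w"
proof (cases \<alpha>)
  case Nil
  then show ?thesis using that assms by (auto simp: awalk_Nil_iff)
next
  case (Cons e \<beta>)
  then have "(vx (tail E e) * ed e) * (path \<beta> * vx w) \<approx> ed e * (path \<beta> * vx w)"
    using assms by (intro cong_right gen_cong) auto
  then have "vx (tail E e) * path \<alpha> * vx w \<notin> P"
    using assms(3) cong_mem_iff by (simp add: Cons path_Cons mult.assoc)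
  then show ?thesis
    using that[of "tail E e"] not_awalk_imp_mem[of \<alpha> "tail E e" w] assms Cons by auto
qed

text \<open>The claim for all larger finite sets \<open>B\<close> is what passes to sums: for
  \<open>x + y\<close> the union of the two sets works.\<close>

lemma local_unit_finite:
  assumes "x \<in> F0"
  shows "\<exists>A. finite A \<and> A \<subseteq> verts E \<and> (\<forall>B. finite B \<and> A \<subseteq> B \<and> B \<subseteq> verts E \<longrightarrow> x * (\<Sum>v\<in>B. vx v) \<approx> x)"
  using assms
proof (induction x rule: nonunital_free_induct)
  case zero
  then show ?case by (auto intro: exI[of _ "{}"])
next
  case (add x y)
  from add.IH(1) obtain A where A: "finite A" "A \<subseteq> verts E"
    "\<forall>C. finite C \<and> A \<subseteq> C \<and> C \<subseteq> verts E \<longrightarrow> x * (\<Sum>v\<in>C. vx v) \<approx> x"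
    by auto
  from add.IH(2) obtain B where B: "finite B" "B \<subseteq> verts E"
    "\<forall>C. finite C \<and> B \<subseteq> C \<and> C \<subseteq> verts E \<longrightarrow> y * (\<Sum>v\<in>C. vx v) \<approx> y"
    by auto
  have "(x + y) * (\<Sum>v\<in>C. vx v) \<approx> x + y" if "finite C" "A \<union> B \<subseteq> C" "C \<subseteq> verts E" for C
    unfolding distrib_right using that A(3) B(3) by (intro cong_add) simp_all
  then show ?case
    using A B by (intro exI[of _ "A \<union> B"]) simp
next
  case (mon ws c)
  define us g where "us = butlast ws" and "g = last ws"
  have ws: "ws = us @ [g]" and g: "g \<in> lpa_gens E" "set us \<subseteq> lpa_gens E"
    using mon by (auto simp: us_def g_def dest: in_set_butlastD)
  \<comment> \<open>Modulo \<open>P\<close> the last letter of the word has one vertex as a right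
    unit and is killed by all others, and the word inherits this.\<close>
  obtain w where w: "w \<in> verts E" "\<forall>v\<in>verts E. gen g * vx v \<approx> (if v = w then gen g else 0)"
  proof (cases g)
    case (Vertex v)
    then have v: "v \<in> verts E" using g by simp
    have "\<forall>u\<in>verts E. gen g * vx u \<approx> (if u = v then gen g else 0)"
    proof
      fix u assume "u \<in> verts E"
      then show "gen g * vx u \<approx> (if u = v then gen g else 0)"
        using gen_cong(1)[OF v, of u] Vertex by (cases "u = v") auto
    qed
    then show ?thesis using that[of v] v by blast
  next
    case (Edge e)
    then have "e \<in> arcs E" using g by simp
    then show ?thesis using that[of "head E e"] Edge ed_vx[of _ e] by auto
  next
    case (Ghost e)
    then have "e \<in> arcs E" using g by simp
    then show ?thesis using that[of "tail E e"] Ghost gh_vx[of _ e] by auto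
  qed
  have "scalar c * mon ws * (\<Sum>v\<in>B. vx v) \<approx> scalar c * mon ws"
    if B: "finite B" "w \<in> B" "B \<subseteq> verts E" for B
  proof -
    have "gen g * (\<Sum>v\<in>B. vx v) \<approx> (\<Sum>v\<in>B. if v = w then gen g else 0)"
      unfolding sum_distrib_left by (intro cong_sum) (use w(2) B(3) in blast)
    then have "gen g * (\<Sum>v\<in>B. vx v) \<approx> gen g"
      using B by (simp add: sum.delta)
    then have "(scalar c * mon us) * (gen g * (\<Sum>v\<in>B. vx v)) \<approx> (scalar c * mon us) * gen g"
      using g by (intro cong_left) auto
    then show ?thesis
      by (simp add: ws mon_append gen_eq_mon mult.assoc)
  qed
  then show ?case
    using w(1) by (intro exI[of _ "{w}"]) auto
qed

lemma local_unit:
  assumes "x \<in> F0"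
  obtains A where "finite A" "A \<subseteq> verts E" "x * (\<Sum>v\<in>A. vx v) \<approx> x"
  using local_unit_finite[OF assms] by blast

lemma exists_vx_not_mem:
  assumes "x \<in> F0" "x \<notin> P"
  obtains w where "w \<in> verts E" "x * vx w \<notin> P"
proof -
  obtain A where A: "finite A" "A \<subseteq> verts E" "x * (\<Sum>v\<in>A. vx v) \<approx> x"
    using local_unit[OF assms(1)] by blast
  have "\<exists>v\<in>A. x * vx v \<notin> P"
  proof (rule ccontr)
    assume "\<not> ?thesis"
    then have "(\<Sum>v\<in>A. x * vx v) \<in> P"
      by (intro sum_mem) blast
    then show False
      using assms(2) cong_mem_iff[OF A(3)] by (simp add: sum_distrib_left)
  qed
  then show ?thesis
    using that A(2) by blast
qed

text \<open>An idempotent of degree 0: \<open>w\<close> minus the part of it that passes through the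
  edges in \<open>F\<close>. For regular \<open>w\<close> and \<open>F = out_arcs E w\<close> it
  lies in \<open>P\<close> by \<open>CK2\<close>. The elements attached to breaking vertices in the
  classification of graded ideals have this form.\<close>

definition gap :: "'v \<Rightarrow> 'e set \<Rightarrow> (('v, 'e) lpa_gen, 'k) free_poly" where
  "gap w F = vx w - (\<Sum>f\<in>F. ed f * gh f)"

lemma gap_empty [simp]: "gap w {} = vx w"
  by (simp add: gap_def)

lemma homogeneous_gap: "homogeneous 0 (gap w F)"
  unfolding gap_def
  by (intro homogeneous_diff homogeneous_sum homogeneous_gen_mult_gen homogeneous_gen') simp_all

lemma gap_free:
  assumes "w \<in> verts E" "F \<subseteq> out_arcs E w"
  shows "gap w F \<in> F0" "gap w F \<in> F1"
proof -
  have "ed f * gh f \<in> F0" if "f \<in> F" for f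
    using that assms(2) by (intro nonunital_free_intros(6)) auto
  then show "gap w F \<in> F0"
    unfolding gap_def using assms(1) by (intro nonunital_free_intros(3,7) nonunital_free_sum) auto
  then show "gap w F \<in> F1"
    by (rule nonunital_imp_unital)
qed

lemma vx_gap:
  assumes "w \<in> verts E" "F \<subseteq> out_arcs E w" "u \<in> verts E"
  shows "vx u * gap w F \<approx> (if u = w then gap w F else 0)"
proof -
  have F: "f \<in> arcs E" "tail E f = w" if "f \<in> F" for f
    using assms(2) that by auto
  have "vx u * gap w F = vx u * vx w - (\<Sum>f\<in>F. (vx u * ed f) * gh f)"
    by (simp add: gap_def right_diff_distrib sum_distrib_left mult.assoc)
  also have "\<dots> \<approx> (if u = w then vx u else 0) - (\<Sum>f\<in>F. (if u = tail E f then ed f else 0) * gh f)"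
    using F assms by (intro cong_diff cong_sum cong_right gen_cong vx_ed) auto
  also have "\<dots> = (if u = w then gap w F else 0)"
    using F by (auto simp: gap_def)
  finally show ?thesis .
qed

text \<open>The vertex contributes \<open>gh f\<close> if \<open>f\<close> leaves \<open>w\<close>,
  the sum subtracts it if \<open>f\<close> is in \<open>F\<close>. Under the last hypothesis these
  conditions agree.\<close>

lemma gh_gap:
  assumes "w \<in> verts E" "finite F" "F \<subseteq> out_arcs E w" "f \<in> arcs E" "f \<in> F \<or> tail E f \<noteq> w"
  shows "gh f * gap w F \<in> P"
proof -
  have F: "g \<in> arcs E" "tail E g = w" if "g \<in> F" for g
    using assms(3) that by auto
  have "gh f * gap w F = gh f * vx w - (\<Sum>g\<in>F. (gh f * ed g) * gh g)"
    by (simp add: gap_def right_diff_distrib sum_distrib_left mult.assoc)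
  also have "\<dots> \<approx> (if w = tail E f then gh f else 0) -
      (\<Sum>g\<in>F. (if f = g then vx (head E f) else 0) * gh g)"
    using F assms by (intro cong_diff cong_sum cong_right gen_cong gh_vx) auto
  also have "(\<Sum>g\<in>F. (if f = g then vx (head E f) else 0) * gh g) =
      (\<Sum>g\<in>F. if f = g then vx (head E f) * gh g else 0)"
    by (rule sum.cong) auto
  also have "\<dots> = (if f \<in> F then vx (head E f) * gh f else 0)"
    using assms(2) by (simp add: sum.delta')
  also have "(if w = tail E f then gh f else 0) - \<dots> \<approx> (if w = tail E f then gh f else 0) -
      (if f \<in> F then gh f else 0)"
    using gen_cong(4)[OF assms(4)] by (intro cong_diff) auto
  also have "\<dots> = 0"
    using assms(5) F by auto
  finally show ?thesis
    by simp
qed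

lemma gap_idem:
  assumes "w \<in> verts E" "finite F" "F \<subseteq> out_arcs E w"
  shows "gap w F * gap w F \<approx> gap w F"
proof -
  have F: "f \<in> arcs E" if "f \<in> F" for f
    using assms(3) that by auto
  have "gap w F * gap w F = vx w * gap w F - (\<Sum>f\<in>F. ed f * (gh f * gap w F))"
    by (subst gap_def) (simp add: left_diff_distrib sum_distrib_right mult.assoc)
  also have "\<dots> \<approx> gap w F - (\<Sum>f\<in>F. 0)"
    using vx_gap[OF assms(1,3,1)] gh_gap[OF assms(1-3)] F
    by (intro cong_diff cong_sum) (auto intro: left_mem)
  finally show ?thesis
    by simp
qed


section \<open>Normal forms\<close>

text \<open>
  Elements represented, modulo \<open>P\<close>, by combinations of \<open>\<alpha>\<beta>\<^sup>*\<close> with \<open>\<beta>\<close> of length at most \<open>d\<close>.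
\<close>

inductive_set normal_span :: "nat \<Rightarrow> (('v, 'e) lpa_gen, 'k) free_poly set" for d where
  zero: "0 \<in> normal_span d"
| add: "x \<in> normal_span d \<Longrightarrow> w \<in> verts E \<Longrightarrow> set \<alpha> \<subseteq> arcs E \<Longrightarrow> set \<beta> \<subseteq> arcs E \<Longrightarrow> length \<beta> \<le> d \<Longrightarrow>
    x + scalar c * (path \<alpha> * vx w * ghost_path \<beta>) \<in> normal_span d"
| modulo: "x \<in> normal_span d \<Longrightarrow> x \<approx> y \<Longrightarrow> y \<in> normal_span d"

lemma normal_span_add:
  assumes "x \<in> normal_span d" "y \<in> normal_span d"
  shows "x + y \<in> normal_span d"
  using assms(2)
proof induction
  case zero
  then show ?case using assms(1) by simp
next
  case (add y w \<alpha> \<beta> c)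
  then show ?case
    using normal_span.add[of "x + y"] by (simp add: add.assoc)
next
  case (modulo y z)
  then show ?case
    using normal_span.modulo[OF _ cong_add[OF cong_refl]] by blast
qed

lemma normal_span_scalar: "x \<in> normal_span d \<Longrightarrow> scalar a * x \<in> normal_span d"
proof (induction rule: normal_span.induct)
  case zero
  then show ?case using normal_span.zero by simp
next
  case (add x w \<alpha> \<beta> c)
  then show ?case
    using normal_span.add[of "scalar a * x" d w \<alpha> \<beta> "a * c"]
    by (simp add: distrib_left scalar_mult flip: mult.assoc)
next
  case (modulo x y)
  then show ?case
    using normal_span.modulo[OF _ cong_left] by blast
qed

lemma normal_span_basic:
  "w \<in> verts E \<Longrightarrow> set \<alpha> \<subseteq> arcs E \<Longrightarrow> set \<beta> \<subseteq> arcs E \<Longrightarrow> length \<beta> \<le> d \<Longrightarrow>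
    path \<alpha> * vx w * ghost_path \<beta> \<in> normal_span d"
  using normal_span.add[OF normal_span.zero, of w \<alpha> \<beta> d 1] by simp

lemma normal_span_mono: "x \<in> normal_span d \<Longrightarrow> d \<le> d' \<Longrightarrow> x \<in> normal_span d'"
  by (induction rule: normal_span.induct) (auto intro: normal_span.intros)

lemma normal_span_mult:
  assumes "x \<in> normal_span d" "a \<in> F1"
    and "\<And>w \<alpha> \<beta>. w \<in> verts E \<Longrightarrow> set \<alpha> \<subseteq> arcs E \<Longrightarrow> set \<beta> \<subseteq> arcs E \<Longrightarrow> length \<beta> \<le> d \<Longrightarrow>
      path \<alpha> * vx w * ghost_path \<beta> * a \<in> normal_span d'"
  shows "x * a \<in> normal_span d'"
  using assms(1)
proof induction
  case zero
  then show ?case using normal_span.zero by simp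
next
  case (add x w \<alpha> \<beta> c)
  then show ?case
    using normal_span_add[OF _ normal_span_scalar[OF assms(3)[of w \<alpha> \<beta>]]]
    by (simp add: distrib_right mult.assoc)
next
  case (modulo x y)
  then show ?case
    using normal_span.modulo[OF _ cong_right] assms(2) by blast
qed

lemma normal_span_basic_vx:
  assumes "w \<in> verts E" "set \<alpha> \<subseteq> arcs E" "set \<beta> \<subseteq> arcs E" "length \<beta> \<le> d" "v \<in> verts E"
  shows "path \<alpha> * vx w * ghost_path \<beta> * vx v \<in> normal_span d"
proof (cases \<beta>)
  case Nil
  have 1: "path \<alpha> * (if w = v then vx w else 0) \<in> normal_span d"
    using normal_span_basic[of w \<alpha> "[]" d] assms by (auto intro: normal_span.zero)
  have 2: "path \<alpha> * (if w = v then vx w else 0) \<approx> path \<alpha> * (vx w * vx v)"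
    using assms by (intro cong_left cong_sym[OF gen_cong(1)]) auto
  show ?thesis
    using normal_span.modulo[OF 1 2] by (simp add: Nil mult.assoc)
next
  case (Cons f \<beta>')
  have 1: "path \<alpha> * vx w * ghost_path \<beta>' * (if v = tail E f then gh f else 0) \<in> normal_span d"
    using normal_span_basic[of w \<alpha> \<beta> d] assms
    by (auto intro: normal_span.zero simp: Cons ghost_path_Cons mult.assoc)
  have 2: "path \<alpha> * vx w * ghost_path \<beta>' * (if v = tail E f then gh f else 0) \<approx>
      path \<alpha> * vx w * ghost_path \<beta>' * (gh f * vx v)"
    using assms Cons by (intro cong_left cong_sym[OF gh_vx]) auto
  show ?thesis
    using normal_span.modulo[OF 1 2] by (simp add: Cons ghost_path_Cons mult.assoc)
qed

lemma normal_span_vx: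
  "x \<in> normal_span d \<Longrightarrow> v \<in> verts E \<Longrightarrow> x * vx v \<in> normal_span d"
  by (rule normal_span_mult) (auto intro: normal_span_basic_vx)

lemma normal_span_gh:
  "x \<in> normal_span d \<Longrightarrow> f \<in> arcs E \<Longrightarrow> x * gh f \<in> normal_span (Suc d)"
proof (rule normal_span_mult)
  fix w \<alpha> \<beta>
  assume "f \<in> arcs E" "w \<in> verts E" "set \<alpha> \<subseteq> arcs E" "set \<beta> \<subseteq> arcs E" "length \<beta> \<le> d"
  then show "path \<alpha> * vx w * ghost_path \<beta> * gh f \<in> normal_span (Suc d)"
    using normal_span_basic[of w \<alpha> "f # \<beta>" "Suc d"] by (simp add: ghost_path_Cons mult.assoc)
qed auto

text \<open>The ghost of the first edge of \<open>\<beta>\<close> stands last, so an edge on the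
  right turns it into a vertex or kills the term. Terms without ghosts absorb the edge into
  \<open>\<alpha>\<close>, which is why truncated subtraction is right for
  \<open>d = 0\<close>.\<close>

lemma normal_span_ed:
  "x \<in> normal_span d \<Longrightarrow> e \<in> arcs E \<Longrightarrow> x * ed e \<in> normal_span (d - 1)"
proof (rule normal_span_mult)
  fix w \<alpha> \<beta>
  assume *: "e \<in> arcs E" "w \<in> verts E" "set \<alpha> \<subseteq> arcs E" "set \<beta> \<subseteq> arcs E" "length \<beta> \<le> d"
  show "path \<alpha> * vx w * ghost_path \<beta> * ed e \<in> normal_span (d - 1)"
  proof (cases \<beta>)
    case Nil
    have 1: "path \<alpha> * (ed e * vx (head E e)) \<in> normal_span (d - 1)"
      using normal_span_basic[of "head E e" "\<alpha> @ [e]" "[]" "d - 1"] *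
      by (simp add: path_append path_Cons mult.assoc)
    have 2: "path \<alpha> * (ed e * vx (head E e)) \<approx> path \<alpha> * ed e"
      using * by (intro cong_left gen_cong) auto
    have "path \<alpha> * ed e \<in> normal_span (d - 1)"
      by (rule normal_span.modulo[OF 1 2])
    then have 1: "path \<alpha> * (if w = tail E e then ed e else 0) \<in> normal_span (d - 1)"
      by (auto intro: normal_span.zero)
    have 2: "path \<alpha> * (if w = tail E e then ed e else 0) \<approx> path \<alpha> * (vx w * ed e)"
      using * by (intro cong_left cong_sym[OF vx_ed]) auto
    show ?thesis
      using normal_span.modulo[OF 1 2] by (simp add: Nil mult.assoc)
  next
    case (Cons f \<beta>')
    have 1: "path \<alpha> * vx w * ghost_path \<beta>' * (if f = e then vx (head E f) else 0) \<in> normal_span (d - 1)"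
      using normal_span_basic_vx[of w \<alpha> \<beta>' "d - 1" "head E f"] * Cons
      by (auto intro: normal_span.zero)
    have 2: "path \<alpha> * vx w * ghost_path \<beta>' * (if f = e then vx (head E f) else 0) \<approx>
        path \<alpha> * vx w * ghost_path \<beta>' * (gh f * ed e)"
      using * Cons by (intro cong_left cong_sym[OF gen_cong(6)]) auto
    show ?thesis
      using normal_span.modulo[OF 1 2] by (simp add: Cons ghost_path_Cons mult.assoc)
  qed
qed auto

lemma mon_normal_span:
  assumes "ws \<noteq> []" "set ws \<subseteq> lpa_gens E"
  shows "\<exists>d. mon ws \<in> normal_span d"
  using assms
proof (induction ws rule: rev_nonempty_induct)
  case (single g)
  show ?case
  proof (cases g)
    case (Vertex v)
    then show ?thesis
      using normal_span_basic[of v "[]" "[]" 0] single by (auto simp flip: gen_eq_mon)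
  next
    case (Edge e)
    then have e: "e \<in> arcs E" using single by simp
    then have "ed e * vx (head E e) \<in> normal_span 0"
      using normal_span_basic[of "head E e" "[e]" "[]" 0] by (simp add: path_Cons)
    then show ?thesis
      using normal_span.modulo[OF _ gen_cong(3)[OF e]] Edge by (auto simp flip: gen_eq_mon)
  next
    case (Ghost e)
    then have e: "e \<in> arcs E" using single by simp
    then have "vx (head E e) * gh e \<in> normal_span 1"
      using normal_span_basic[of "head E e" "[]" "[e]" 1] by (simp add: ghost_path_Cons)
    then show ?thesis
      using normal_span.modulo[OF _ gen_cong(4)[OF e]] Ghost by (auto simp flip: gen_eq_mon)
  qed
next
  case (snoc g ws)
  then obtain d where d: "mon ws \<in> normal_span d"
    by auto
  have eq: "mon (ws @ [g]) = mon ws * gen g"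
    by (simp add: mon_append gen_eq_mon)
  show ?case
    unfolding eq using snoc.prems normal_span_vx[OF d] normal_span_ed[OF d] normal_span_gh[OF d]
    by (cases g) auto
qed

lemma exists_normal_span:
  assumes "x \<in> F0"
  shows "\<exists>d. x \<in> normal_span d"
  using assms
proof (induction x rule: nonunital_free_induct)
  case zero
  then show ?case using normal_span.zero by auto
next
  case (add x y)
  then obtain d d' where "x \<in> normal_span d" "y \<in> normal_span d'"
    by auto
  then have "x \<in> normal_span (max d d')" "y \<in> normal_span (max d d')"
    by (auto intro: normal_span_mono)
  then show ?case
    using normal_span_add by blast
next
  case (mon ws c)
  then show ?case
    using mon_normal_span normal_span_scalar by blast
qed


section \<open>Reduction to paths\<close>

abbreviation path_algebra :: "(('v, 'e) lpa_gen, 'k) free_poly set" where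
  "path_algebra \<equiv> unital_free (Edge ` arcs E)"

lemma path_algebra_path [intro]: "set \<alpha> \<subseteq> arcs E \<Longrightarrow> path \<alpha> \<in> path_algebra"
  unfolding path_def by (rule unital_free_intros(8)) auto

lemma path_algebra_sum:
  assumes "p \<in> path_algebra"
  obtains T k where "finite T" "\<forall>\<alpha>\<in>T. set \<alpha> \<subseteq> arcs E"
    "p = (\<Sum>\<alpha>\<in>T. scalar (k \<alpha>) * path \<alpha>)"
proof
  let ?h = "\<lambda>\<alpha>. Word (map Edge \<alpha>) :: ('v, 'e) lpa_gen free_word"
  have inj: "inj ?h"
    by (rule injI) (auto dest: map_injective intro: injI)
  let ?T = "?h -` Poly_Mapping.keys p"
  show "finite ?T"
    by (rule finite_vimageI[OF finite_keys inj])
  show "\<forall>\<alpha>\<in>?T. set \<alpha> \<subseteq> arcs E"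
    using assms by (force simp: unital_free_def)
  have "Poly_Mapping.keys p \<subseteq> range ?h"
  proof
    fix w assume "w \<in> Poly_Mapping.keys p"
    then have "\<forall>g\<in>set (letters w). g \<in> range Edge"
      using assms by (force simp: unital_free_def)
    then have "letters w \<in> range (map Edge)"
      by (metis ex_map_conv imageE rangeI)
    then show "w \<in> range ?h"
      by (metis (no_types, lifting) free_word.collapse imageE rangeI)
  qed
  then have keys: "Poly_Mapping.keys p = ?h ` ?T"
    by auto
  have "p = (\<Sum>w\<in>?h ` ?T. Poly_Mapping.single w (Poly_Mapping.lookup p w))"
    unfolding keys[symmetric] by (simp add: poly_mapping_sum_single)
  also have "\<dots> = (\<Sum>\<alpha>\<in>?T. Poly_Mapping.single (?h \<alpha>) (Poly_Mapping.lookup p (?h \<alpha>)))"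
    by (rule sum.reindex_cong[OF inj_on_subset[OF inj subset_UNIV] refl refl])
  finally show "p = (\<Sum>\<alpha>\<in>?T. scalar (Poly_Mapping.lookup p (?h \<alpha>)) * path \<alpha>)"
    by (simp only: path_def single_eq_scalar_mon)
qed

text \<open>A term with a nontrivial ghost ends in the ghost of the first edge \<open>f\<close> of
  \<open>\<beta>\<close>, and \<open>gap w F\<close> kills that as soon as \<open>F\<close> contains
  \<open>f\<close> or \<open>f\<close> does not leave \<open>w\<close>. Finitely many terms need a
  finite \<open>F\<close> only. Without ghosts nothing has to be removed, hence
  \<open>F = {}\<close> for \<open>d = 0\<close>.\<close>

lemma normal_span_gap:
  assumes "x \<in> normal_span d" "w \<in> verts E"
  obtains p F where "p \<in> path_algebra" "finite F" "F \<subseteq> out_arcs E w" "d = 0 \<longrightarrow> F = {}"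
    "x * gap w F \<approx> p * gap w F"
proof -
  \<comment> \<open>Validity for every finite \<open>F\<close> above \<open>H1\<close> makes the
    property additive: the sets of two summands are united.\<close>
  define S where "S x p H1 \<longleftrightarrow> p \<in> path_algebra \<and> finite H1 \<and> H1 \<subseteq> out_arcs E w \<and> (d = 0 \<longrightarrow> H1 = {}) \<and>
    (\<forall>F. finite F \<and> H1 \<subseteq> F \<and> F \<subseteq> out_arcs E w \<longrightarrow> x * gap w F \<approx> p * gap w F)" for x p H1
  have basic: "\<exists>p H1. S (path \<alpha> * vx u * ghost_path \<beta>) p H1"
    if u: "u \<in> verts E" and \<alpha>: "set \<alpha> \<subseteq> arcs E" and \<beta>: "set \<beta> \<subseteq> arcs E" "length \<beta> \<le> d" for u \<alpha> \<beta>
  proof (cases \<beta>)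
    case Nil
    let ?q = "if u = w then path \<alpha> else 0"
    have "path \<alpha> * vx u * gap w F \<approx> ?q * gap w F" if "F \<subseteq> out_arcs E w" for F
    proof -
      have "path \<alpha> * (vx u * gap w F) \<approx> path \<alpha> * (if u = w then gap w F else 0)"
        by (rule cong_left[OF vx_gap[OF assms(2) that u]]) (use \<alpha> in auto)
      also have "\<dots> = ?q * gap w F"
        by (cases "u = w") simp_all
      finally show ?thesis
        by (simp only: mult.assoc)
    qed
    moreover have "?q \<in> path_algebra"
      using \<alpha> by auto
    ultimately have "S (path \<alpha> * vx u * ghost_path \<beta>) ?q {}"
      unfolding S_def Nil ghost_path_Nil mult_1_right by blast
    then show ?thesis
      by blast
  next
    case (Cons f \<beta>')
    let ?F = "if tail E f = w then {f} else {}"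
    have f: "f \<in> arcs E" "set \<beta>' \<subseteq> arcs E"
      using \<beta> Cons by auto
    have "path \<alpha> * vx u * ghost_path \<beta> * gap w F \<approx> 0 * gap w F"
      if F: "finite F" "?F \<subseteq> F" "F \<subseteq> out_arcs E w" for F
    proof -
      have "gh f * gap w F \<in> P"
        by (rule gh_gap[OF assms(2) F(1,3) f(1)]) (use F(2) in \<open>auto split: if_splits\<close>)
      moreover have "path \<alpha> * vx u * ghost_path \<beta>' \<in> F1"
        using u \<alpha> f by auto
      ultimately have "path \<alpha> * vx u * ghost_path \<beta>' * (gh f * gap w F) \<in> P"
        by (rule left_mem)
      then show ?thesis
        by (simp add: Cons ghost_path_Cons mult.assoc)
    qed
    moreover have "finite ?F" "?F \<subseteq> out_arcs E w" "d = 0 \<longrightarrow> ?F = {}"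
      using f \<beta> Cons by auto
    ultimately have "S (path \<alpha> * vx u * ghost_path \<beta>) 0 ?F"
      unfolding S_def by blast
    then show ?thesis
      by blast
  qed
  have "\<exists>p H1. S x p H1"
    using assms(1)
  proof induction
    case zero
    have "S 0 0 {}"
      by (simp add: S_def)
    then show ?case
      by blast
  next
    case (modulo x y)
    then obtain p H1 where S: "S x p H1"
      by blast
    have "y * gap w F \<approx> p * gap w F" if "finite F" "H1 \<subseteq> F" "F \<subseteq> out_arcs E w" for F
    proof -
      have "y * gap w F \<approx> x * gap w F"
        by (rule cong_right[OF cong_sym[OF modulo.hyps(2)] gap_free(2)[OF assms(2) that(3)]])
      also have "\<dots> \<approx> p * gap w F"
        using S that by (simp add: S_def)
      finally show ?thesis .
    qed
    then have "S y p H1"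
      using S by (simp add: S_def)
    then show ?case
      by blast
  next
    case (add x u \<alpha> \<beta> c)
    let ?b = "path \<alpha> * vx u * ghost_path \<beta>"
    obtain p H1 where p: "S x p H1"
      using add.IH by blast
    obtain q H2 where q: "S ?b q H2"
      using basic[OF add.hyps(2-5)] by blast
    have "(x + scalar c * ?b) * gap w F \<approx> (p + scalar c * q) * gap w F"
      if "finite F" "H1 \<union> H2 \<subseteq> F" "F \<subseteq> out_arcs E w" for F
    proof -
      have "x * gap w F + scalar c * (?b * gap w F) \<approx> p * gap w F + scalar c * (q * gap w F)"
      proof (rule cong_add[OF _ cong_left])
        show "x * gap w F \<approx> p * gap w F"
          using that p by (simp add: S_def)
        show "?b * gap w F \<approx> q * gap w F"
          using that q by (simp add: S_def)
      qed simp
      then show ?thesis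
        by (simp add: distrib_right mult.assoc)
    qed
    moreover have "p + scalar c * q \<in> path_algebra" "finite (H1 \<union> H2)" "H1 \<union> H2 \<subseteq> out_arcs E w"
        "d = 0 \<longrightarrow> H1 \<union> H2 = {}"
      using p q by (simp_all add: S_def)
    ultimately have "S (x + scalar c * ?b) (p + scalar c * q) (H1 \<union> H2)"
      by (simp add: S_def)
    then show ?case
      by blast
  qed
  then obtain p H where "S x p H"
    by blast
  then show ?thesis
    using that[of p H] by (simp add: S_def)
qed

lemma path_gap_not_mem_imp_awalk:
  assumes "w \<in> verts E" "F \<subseteq> out_arcs E w" "set \<alpha> \<subseteq> arcs E" "path \<alpha> * gap w F \<notin> P"
  obtains u where "awalk u \<alpha> w"
proof -
  have "path \<alpha> * (vx w * gap w F) \<approx> path \<alpha> * gap w F"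
    using vx_gap[OF assms(1,2,1)] assms(3) by (intro cong_left) auto
  then have "path \<alpha> * vx w * gap w F \<notin> P"
    using assms(4) cong_mem_iff by (metis mult.assoc)
  then have "path \<alpha> * vx w \<notin> P"
    using right_mem gap_free[OF assms(1,2)] by blast
  then show ?thesis
    using path_vx_not_mem_imp_awalk assms(1,3) that by blast
qed

text \<open>\<open>a\<close> and \<open>b\<close> compress a combination of paths ending in
  \<open>w\<close> to its scalar term: they preserve the gap and destroy every nonempty path of
  length at most \<open>m\<close> before it. For nonempty \<open>F\<close> the gap itself serves as
  \<open>a\<close>, since it kills edges on its right.\<close>

lemma gap_conjugation:
  assumes K: "condition_K E" and w: "w \<in> verts E" and F: "finite F" "F \<subseteq> out_arcs E w"
    and sink: "F = {} \<or> (\<forall>e\<in>arcs E. gap w F * ed e \<in> P)"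
  obtains a b where "a \<in> F1" "b \<in> F1" "a * vx w * gap w F * b \<approx> gap w F"
    "\<And>q. q \<noteq> [] \<Longrightarrow> set q \<subseteq> arcs E \<Longrightarrow> length q \<le> m \<Longrightarrow> a * vx w * path q * gap w F * b \<in> P"
proof (cases "F = {}")
  case False
  have gap: "gap w F \<in> F1"
    using gap_free[OF w F(2)] by simp
  show ?thesis
  proof (rule that[of "gap w F" 1])
    have "gap w F * (vx w * gap w F) \<approx> gap w F * gap w F"
      using vx_gap[OF w F(2) w] gap by (intro cong_left) auto
    also have "\<dots> \<approx> gap w F"
      by (rule gap_idem[OF w F])
    finally show "gap w F * vx w * gap w F * 1 \<approx> gap w F"
      by (simp add: mult.assoc)
    fix q :: "'e list" assume q: "q \<noteq> []" "set q \<subseteq> arcs E"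
    then obtain e q' where eq: "q = e # q'"
      by (cases q) auto
    have e: "e \<in> arcs E" "set q' \<subseteq> arcs E"
      using q eq by auto
    have "gap w F * (vx w * ed e) \<approx> gap w F * (if w = tail E e then ed e else 0)"
      using gap e w by (intro cong_left vx_ed) auto
    moreover have "gap w F * (if w = tail E e then ed e else 0) \<in> P"
      using sink False e by auto
    ultimately have "gap w F * (vx w * ed e) \<in> P"
      by (rule cong_mem_iff[THEN iffD2])
    then have "gap w F * (vx w * ed e) * (path q' * gap w F) \<in> P"
      by (rule right_mem) (use e gap in auto)
    then show "gap w F * vx w * path q * gap w F * 1 \<in> P"
      by (simp add: eq path_Cons mult.assoc)
  qed (use gap in auto)
next
  case True
  have ww: "vx w * vx w \<approx> vx w"
    by (rule vx_idem[OF w])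
  show ?thesis
  proof (cases "\<exists>q. awalk w q w \<and> q \<noteq> []")
    case False
    \<comment> \<open>With no closed walk at \<open>w\<close>, nothing nonempty survives between two
      copies of \<open>w\<close>.\<close>
    show ?thesis
    proof (rule that[of 1 1])
      show "1 * vx w * gap w F * 1 \<approx> gap w F"
        using ww True by simp
      fix q :: "'e list" assume q: "q \<noteq> []" "set q \<subseteq> arcs E"
      then have "vx w * path q * vx w \<in> P"
        using False by (intro not_awalk_imp_mem w) auto
      then show "1 * vx w * path q * gap w F * 1 \<in> P"
        using True by simp
    qed auto
  next
    case closed: True
    then obtain q where "awalk w q w" "q \<noteq> []"
      by blast
    then obtain g r where g: "closed_simple_path E w g"
      using closed_walk_decomp by blast
    \<comment> \<open>This is the only use of Condition (K): \<open>g\<close> exists, so it cannot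
      be the unique closed simple path at \<open>w\<close>.\<close>
    then obtain h where h: "closed_simple_path E w h" and gh: "g \<noteq> h"
      using K w unfolding condition_K_def by blast
    define \<gamma> where "\<gamma> = concat (replicate m g) @ h"
    have "awalk w g w" "awalk w h w"
      using g h by (simp_all add: closed_simple_path_def)
    then have walk: "awalk w \<gamma> w"
      unfolding \<gamma>_def by (rule awalk_appendI[OF awalk_concat_replicate])
    then have \<gamma>: "set \<gamma> \<subseteq> arcs E"
      by auto
    have gv: "vx w * ghost_path \<gamma> * vx w \<approx> vx w * ghost_path \<gamma>"
      by (rule ghost_path_vx[OF walk])
    have vp: "vx w * path \<gamma> * vx w \<approx> path \<gamma> * vx w"
      by (rule vx_path[OF walk])
    show ?thesis
    proof (rule that[of "vx w * ghost_path \<gamma>" "path \<gamma> * vx w"])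
      have "vx w * ghost_path \<gamma> * vx w * (vx w * path \<gamma> * vx w) \<approx>
          vx w * ghost_path \<gamma> * vx w * (path \<gamma> * vx w)"
        using vp w \<gamma> by (intro cong_left) auto
      also have "\<dots> \<approx> vx w * ghost_path \<gamma> * (path \<gamma> * vx w)"
        using gv w \<gamma> by (intro cong_right) auto
      also have "\<dots> = vx w * ghost_path \<gamma> * path \<gamma> * vx w"
        by (simp add: mult.assoc)
      also have "\<dots> \<approx> vx w * vx w"
        using ghost_path_path[OF walk] w by (intro cong_right) auto
      also note ww
      finally show "vx w * ghost_path \<gamma> * vx w * gap w F * (path \<gamma> * vx w) \<approx> gap w F"
        by (simp add: True mult.assoc)
      fix q :: "'e list" assume q: "q \<noteq> []" "set q \<subseteq> arcs E" "length q \<le> m"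
      show "vx w * ghost_path \<gamma> * vx w * path q * gap w F * (path \<gamma> * vx w) \<in> P"
      proof (cases "awalk w q w")
        case False
        then have "vx w * path q * vx w \<in> P"
          using q by (intro not_awalk_imp_mem w) auto
        then have "(vx w * ghost_path \<gamma>) * (vx w * path q * vx w) * (path \<gamma> * vx w) \<in> P"
          using w \<gamma> by - (rule right_mem[OF left_mem], auto)
        then show ?thesis
          by (simp add: True mult.assoc)
      next
        case cq: True
        \<comment> \<open>The product is governed by
          \<open>ghost_path \<gamma> * path (q @ \<gamma>)\<close>, which survives only if
          \<open>\<gamma>\<close> is a prefix of \<open>q @ \<gamma>\<close>.\<close>
        have "(q @ \<gamma>) \<noteq> \<gamma> @ t" for t
          unfolding \<gamma>_def by (rule closed_simple_power_not_prefix[OF g h gh cq q(1,3)])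
        then have "ghost_path \<gamma> * path (q @ \<gamma>) \<in> P"
          using q \<gamma> by (intro ghost_path_path_diff) auto
        then have mem: "vx w * (ghost_path \<gamma> * path (q @ \<gamma>)) * vx w \<in> P"
          using w by - (rule right_mem[OF left_mem], auto)
        have "vx w * ghost_path \<gamma> * vx w * path q * (vx w * path \<gamma> * vx w) \<approx>
            vx w * ghost_path \<gamma> * vx w * path q * (path \<gamma> * vx w)"
          using vp w \<gamma> q by (intro cong_left) auto
        also have "\<dots> = vx w * ghost_path \<gamma> * vx w * (path q * (path \<gamma> * vx w))"
          by (simp add: mult.assoc)
        also have "\<dots> \<approx> vx w * ghost_path \<gamma> * (path q * (path \<gamma> * vx w))"
          using gv w \<gamma> q by (intro cong_right) auto
        also have "\<dots> = vx w * (ghost_path \<gamma> * path (q @ \<gamma>)) * vx w"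
          by (simp add: path_append mult.assoc)
        also have "\<dots> \<approx> 0"
          using mem by simp
        finally show ?thesis
          by (simp add: True mult.assoc)
      qed
    qed (use w \<gamma> in auto)
  qed
qed

end


section \<open>Graded ideals\<close>

locale graded_lpa_ideal = lpa_ideal +
  assumes hcomp_mem: "x \<in> P \<Longrightarrow> hcomp n x \<in> P"
begin

text \<open>The component of degree \<open>length \<alpha>0 + n\<close> keeps exactly the terms
  whose path is as long as \<open>\<alpha>0\<close>. Among these the ghost of
  \<open>\<alpha>0\<close> kills all but its own, leaving a nonzero multiple of
  \<open>y\<close>.\<close>

lemma coefficient_mem:
  assumes T: "finite T" "\<forall>\<alpha>\<in>T. set \<alpha> \<subseteq> arcs E"
    and y: "y \<in> F1" "homogeneous n y" "vx w * y \<approx> y"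
    and mem: "(\<Sum>\<alpha>\<in>T. scalar (k \<alpha>) * path \<alpha>) * y \<in> P"
    and \<alpha>0: "\<alpha>0 \<in> T" "awalk u \<alpha>0 w" "k \<alpha>0 \<noteq> 0"
  shows "y \<in> P"
proof -
  let ?l = "length \<alpha>0"
  let ?G = "vx w * ghost_path \<alpha>0"
  have w: "w \<in> verts E" and arcs: "set \<alpha>0 \<subseteq> arcs E"
    using \<alpha>0(2) by auto
  have G: "?G \<in> F1"
    using w arcs by auto
  have hom: "homogeneous (int (length \<alpha>) + n) (scalar (k \<alpha>) * path \<alpha> * y)" for \<alpha>
    using homogeneous_mult[OF homogeneous_mult[OF homogeneous_scalar[of "k \<alpha>"] homogeneous_path] y(2)]
    by simp
  have "hcomp (int ?l + n) ((\<Sum>\<alpha>\<in>T. scalar (k \<alpha>) * path \<alpha>) * y) =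
      (\<Sum>\<alpha>\<in>T. if length \<alpha> = ?l then scalar (k \<alpha>) * path \<alpha> * y else 0)"
    unfolding sum_distrib_right hcomp_sum using hcomp_homogeneous[OF hom]
    by (intro sum.cong) auto
  then have "(\<Sum>\<alpha>\<in>T. if length \<alpha> = ?l then scalar (k \<alpha>) * path \<alpha> * y else 0) \<in> P"
    using hcomp_mem[OF mem, of "int ?l + n"] by simp
  then have 1: "?G * (\<Sum>\<alpha>\<in>T. if length \<alpha> = ?l then scalar (k \<alpha>) * path \<alpha> * y else 0) \<in> P"
    using G by (rule left_mem)
  have 2: "?G * (\<Sum>\<alpha>\<in>T. if length \<alpha> = ?l then scalar (k \<alpha>) * path \<alpha> * y else 0) \<approx>
      (\<Sum>\<alpha>\<in>T. if \<alpha> = \<alpha>0 then scalar (k \<alpha>) * y else 0)"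
    unfolding sum_distrib_left
  proof (rule cong_sum)
    fix \<alpha> assume \<alpha>: "\<alpha> \<in> T"
    have eq: "?G * (scalar (k \<alpha>) * path \<alpha> * y) = scalar (k \<alpha>) * (?G * path \<alpha> * y)"
    proof -
      have "?G * (scalar (k \<alpha>) * path \<alpha> * y) = (?G * scalar (k \<alpha>)) * (path \<alpha> * y)"
        by (simp only: mult.assoc)
      also have "\<dots> = (scalar (k \<alpha>) * ?G) * (path \<alpha> * y)"
        by (simp only: scalar_commute[of "k \<alpha>" ?G])
      finally show ?thesis
        by (simp only: mult.assoc)
    qed
    show "?G * (if length \<alpha> = ?l then scalar (k \<alpha>) * path \<alpha> * y else 0) \<approx>
        (if \<alpha> = \<alpha>0 then scalar (k \<alpha>) * y else 0)"
    proof (cases "\<alpha> = \<alpha>0")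
      case True
      have "?G * path \<alpha>0 * y \<approx> vx w * y"
        using ghost_path_path[OF \<alpha>0(2)] y(1) by (rule cong_right)
      also note y(3)
      finally have "scalar (k \<alpha>0) * (?G * path \<alpha>0 * y) \<approx> scalar (k \<alpha>0) * y"
        by (rule cong_left) auto
      then show ?thesis
        using True eq by simp
    next
      case False
      have "?G * (scalar (k \<alpha>) * path \<alpha> * y) \<in> P" if "length \<alpha> = ?l"
      proof -
        have "ghost_path \<alpha>0 * path \<alpha> \<in> P"
          using bspec[OF T(2) \<alpha>] arcs that False by (intro ghost_path_path_diff) auto
        then have "(scalar (k \<alpha>) * vx w) * (ghost_path \<alpha>0 * path \<alpha>) * y \<in> P"
          using w y(1) by - (rule right_mem[OF left_mem], auto)
        then show ?thesis
          unfolding eq by (simp add: mult.assoc)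
      qed
      then show ?thesis
        using False by simp
    qed
  qed
  have "(\<Sum>\<alpha>\<in>T. if \<alpha> = \<alpha>0 then scalar (k \<alpha>) * y else 0) \<in> P"
    using cong_mem_iff[OF 2] 1 by (rule iffD1)
  then have "scalar (k \<alpha>0) * y \<in> P"
    using T(1) \<alpha>0(1) by simp
  then show ?thesis
    using \<alpha>0(3) by (rule unscale_mem)
qed

lemma path_sum_not_mem:
  assumes "(\<Sum>\<alpha>\<in>T. scalar (k \<alpha>) * path \<alpha>) * y \<notin> P"
  obtains \<alpha> where "\<alpha> \<in> T" "scalar (k \<alpha>) * path \<alpha> * y \<notin> P"
proof -
  have "\<exists>\<alpha>\<in>T. scalar (k \<alpha>) * path \<alpha> * y \<notin> P"
  proof (rule ccontr)
    assume "\<not> ?thesis"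
    then have "(\<Sum>\<alpha>\<in>T. scalar (k \<alpha>) * path \<alpha> * y) \<in> P"
      by (intro sum_mem) blast
    then show False
      using assms by (simp add: sum_distrib_right)
  qed
  then show ?thesis
    using that by blast
qed

lemma term_not_memD:
  assumes "scalar c * path \<alpha> * y \<notin> P"
  shows "c \<noteq> 0" "path \<alpha> * y \<notin> P"
proof -
  show "c \<noteq> 0"
    using assms by auto
  show "path \<alpha> * y \<notin> P"
    using assms left_mem[of "path \<alpha> * y" "scalar c"] by (auto simp: mult.assoc)
qed

text \<open>The induction is on the bound for ghost lengths. While ghosts may be present and some
  edge leaves \<open>x\<close> outside \<open>P\<close>, multiplying by that edge lowers the bound.
  Otherwise either no ghosts are left or all edges kill \<open>x\<close>; then a gap removes the
  ghosts without losing \<open>x\<close>.\<close>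

lemma reduction:
  assumes "x \<in> normal_span d" "x \<in> F0" "x \<notin> P"
  shows "\<exists>b\<in>F1. \<exists>p\<in>path_algebra. \<exists>w\<in>verts E. \<exists>F. finite F \<and> F \<subseteq> out_arcs E w \<and>
    x * b \<approx> p * gap w F \<and> p * gap w F \<notin> P \<and> (F = {} \<or> (\<forall>e\<in>arcs E. gap w F * ed e \<in> P))"
  using assms
proof (induction d arbitrary: x rule: less_induct)
  case (less d)
  show ?case
  proof (cases "d \<noteq> 0 \<and> (\<exists>e\<in>arcs E. x * ed e \<notin> P)")
    case True
    then obtain e where e: "e \<in> arcs E" "x * ed e \<notin> P" and d: "d - 1 < d"
      by auto
    have "x * ed e \<in> normal_span (d - 1)"
      by (rule normal_span_ed[OF less.prems(1) e(1)])
    moreover have "x * ed e \<in> F0"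
      using less.prems(2) e(1) by (intro nonunital_free_intros(5)) auto
    ultimately have "\<exists>b\<in>F1. \<exists>p\<in>path_algebra. \<exists>w\<in>verts E. \<exists>F. finite F \<and> F \<subseteq> out_arcs E w \<and>
        x * ed e * b \<approx> p * gap w F \<and> p * gap w F \<notin> P \<and> (F = {} \<or> (\<forall>e\<in>arcs E. gap w F * ed e \<in> P))"
      by (rule less.IH[OF d _ _ e(2)])
    then obtain b p w F where "b \<in> F1" "p \<in> path_algebra" "w \<in> verts E"
      "finite F \<and> F \<subseteq> out_arcs E w \<and> x * ed e * b \<approx> p * gap w F \<and> p * gap w F \<notin> P \<and>
        (F = {} \<or> (\<forall>e\<in>arcs E. gap w F * ed e \<in> P))"
      by (elim bexE exE) (rule that)
    then show ?thesis
      using e(1)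
      by - (rule bexI[of _ "ed e * b"], rule bexI[of _ p], rule bexI[of _ w], rule exI[of _ F],
          simp_all add: mult.assoc)
  next
    case False
    obtain w where w: "w \<in> verts E" "x * vx w \<notin> P"
      using exists_vx_not_mem[OF less.prems(2,3)] .
    obtain p F where p: "p \<in> path_algebra" and F: "finite F" "F \<subseteq> out_arcs E w" "d = 0 \<longrightarrow> F = {}"
      and xF: "x * gap w F \<approx> p * gap w F"
      using normal_span_gap[OF less.prems(1) w(1)] .
    have x: "x \<in> F1"
      by (rule nonunital_imp_unital[OF less.prems(2)])
    have farcs: "f \<in> arcs E" if "f \<in> F" for f
      using that F(2) by auto
    \<comment> \<open>A nonempty \<open>F\<close> excludes \<open>d = 0\<close>, so the failed case
      condition says that \<open>x\<close> is killed by every edge.\<close>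
    have arc_mem: "x * ed e \<in> P" if "e \<in> arcs E" "F \<noteq> {}" for e
      using False F(3) that by blast
    have "x * gap w F \<approx> x * vx w"
    proof -
      have "(\<Sum>f\<in>F. x * ed f * gh f) \<in> P"
        by (intro sum_mem right_mem[OF arc_mem]) (use farcs in auto)
      then have "x * vx w - (\<Sum>f\<in>F. x * ed f * gh f) \<approx> x * vx w - 0"
        by (intro cong_diff) simp_all
      then show ?thesis
        by (simp add: gap_def right_diff_distrib sum_distrib_left mult.assoc)
    qed
    from cong_mem_iff[OF this] have "x * gap w F \<notin> P"
      using w(2) by simp
    then have pF: "p * gap w F \<notin> P"
      using cong_mem_iff[OF xF] by simp
    \<comment> \<open>Since edges kill \<open>x\<close>, the element
      \<open>p * gap w F * ed e\<close> is in \<open>P\<close>, and extracting one coefficient of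
      \<open>p\<close> isolates \<open>gap w F * ed e\<close>. The path for it is taken from a term
      of \<open>p * gap w F\<close> outside \<open>P\<close>, so it does end at
      \<open>w\<close>.\<close>
    have sink: "gap w F * ed e \<in> P" if "F \<noteq> {}" "e \<in> arcs E" for e
    proof -
      have "x * vx w * ed e \<in> P"
      proof -
        have "x * (vx w * ed e) \<approx> x * (if w = tail E e then ed e else 0)"
          using x that w(1) by (intro cong_left vx_ed) auto
        from cong_mem_iff[OF this] have "x * (vx w * ed e) \<in> P"
          using arc_mem that by simp
        then show ?thesis
          by (simp add: mult.assoc)
      qed
      moreover have "(\<Sum>f\<in>F. x * ed f * (gh f * ed e)) \<in> P"
        by (intro sum_mem right_mem[OF arc_mem]) (use farcs that in auto)
      ultimately have "x * vx w * ed e - (\<Sum>f\<in>F. x * ed f * (gh f * ed e)) \<in> P"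
        by (rule diff_mem)
      then have "x * gap w F * ed e \<in> P"
        by (simp add: gap_def right_diff_distrib left_diff_distrib sum_distrib_left sum_distrib_right mult.assoc)
      moreover have "x * gap w F * ed e \<approx> p * gap w F * ed e"
        by (rule cong_right[OF xF]) (use that in auto)
      ultimately have "p * gap w F * ed e \<in> P"
        by (rule cong_mem_iff[THEN iffD1, rotated])
      then have mem: "p * (gap w F * ed e) \<in> P"
        by (simp add: mult.assoc)
      obtain T k where T: "finite T" "\<forall>\<alpha>\<in>T. set \<alpha> \<subseteq> arcs E"
        and p_eq: "p = (\<Sum>\<alpha>\<in>T. scalar (k \<alpha>) * path \<alpha>)"
        using path_algebra_sum[OF p] .
      obtain \<alpha>0 where \<alpha>0: "\<alpha>0 \<in> T" "scalar (k \<alpha>0) * path \<alpha>0 * gap w F \<notin> P"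
        using path_sum_not_mem pF unfolding p_eq by blast
      obtain u where u: "awalk u \<alpha>0 w"
        using path_gap_not_mem_imp_awalk[OF w(1) F(2) bspec[OF T(2) \<alpha>0(1)] term_not_memD(2)[OF \<alpha>0(2)]] .
      show ?thesis
      proof (rule coefficient_mem[OF T _ _ _ mem[unfolded p_eq] \<alpha>0(1) u term_not_memD(1)[OF \<alpha>0(2)]])
        show "gap w F * ed e \<in> F1"
          using gap_free[OF w(1) F(2)] that by auto
        show "homogeneous (0 + 1) (gap w F * ed e)"
          using homogeneous_gen[of "Edge e"] by (intro homogeneous_mult homogeneous_gap) simp
        have "vx w * gap w F * ed e \<approx> gap w F * ed e"
          using vx_gap[OF w(1) F(2) w(1)] that by (intro cong_right) auto
        then show "vx w * (gap w F * ed e) \<approx> gap w F * ed e"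
          by (simp add: mult.assoc)
      qed
    qed
    then have "F = {} \<or> (\<forall>e\<in>arcs E. gap w F * ed e \<in> P)"
      by blast
    then show ?thesis
      using gap_free(2)[OF w(1) F(2)] p w(1) F(1,2) xF pF
      by - (rule bexI[of _ "gap w F"], rule bexI[of _ p], rule bexI[of _ w], rule exI[of _ F], simp_all)
  qed
qed

end

section \<open>The largest graded ideal inside an ideal\<close>

context lpa_ideal
begin

definition graded_part :: "(('v, 'e) lpa_gen, 'k) free_poly set" where
  "graded_part = {x \<in> F0. \<forall>n. hcomp n x \<in> P}"

lemma graded_part_subset: "graded_part \<subseteq> P"
proof
  fix x assume "x \<in> graded_part"
  then have "(\<Sum>n\<in>word_degree ` Poly_Mapping.keys x. hcomp n x) \<in> P"
    by (intro sum_mem) (simp add: graded_part_def)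
  then show "x \<in> P"
    by (simp only: sum_hcomp)
qed

lemma homogeneous_mem_graded_part: "x \<in> P \<Longrightarrow> homogeneous n x \<Longrightarrow> x \<in> graded_part"
  unfolding graded_part_def using subset by (simp add: hcomp_homogeneous subset_iff)

text \<open>A generator is a single word, so multiplying by it only shifts components: those of the
  product are products of the generator with components of \<open>x\<close>, which lie in
  \<open>P\<close>.\<close>

lemma graded_part_ideal: "graded_lpa_ideal E graded_part"
proof -
  have "free_ideal (lpa_gens E) graded_part"
  proof (rule free_idealI)
    fix x and c :: 'k
    assume x: "x \<in> graded_part"
    show "scalar c * x \<in> graded_part"
      using x by (auto simp: graded_part_def hcomp_single_mult intro: left_mem)
  next
    fix x :: "(('v, 'e) lpa_gen, 'k) free_poly" and g :: "('v, 'e) lpa_gen"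
    assume x: "x \<in> graded_part" and g: "g \<in> lpa_gens E"
    then have gF: "gen g \<in> F1"
      by (rule_tac unital_free_intros(7))
    have "hcomp n (gen g * x) \<in> P" "hcomp n (x * gen g) \<in> P" for n
      using x left_mem[OF _ gF] right_mem[OF _ gF]
      by (simp_all add: gen_def hcomp_single_mult hcomp_mult_single graded_part_def)
    moreover have "x \<in> F0"
      using x by (simp add: graded_part_def)
    then have "gen g * x \<in> F0" "x * gen g \<in> F0"
      using nonunital_free_intros(5,6) gF by blast+
    ultimately show "gen g * x \<in> graded_part" "x * gen g \<in> graded_part"
      by (simp_all add: graded_part_def)
  qed (auto simp: graded_part_def hcomp_add intro: add_mem)
  moreover have "lpa_relations E \<subseteq> graded_part"
    using relations homogeneous_lpa_relation homogeneous_mem_graded_part by blast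
  moreover have "hcomp n x \<in> graded_part" if "x \<in> graded_part" for n x
    using that homogeneous_mem_graded_part[OF _ homogeneous_hcomp] by (simp add: graded_part_def)
  ultimately show ?thesis
    by (intro graded_lpa_ideal.intro lpa_ideal.intro lpa_ideal_axioms.intro
        graded_lpa_ideal_axioms.intro wf_digraph_axioms)
qed

text \<open>Two ideals are in play: congruences are computed modulo \<open>graded_part\<close>,
  where \<open>reduction\<close> applies, while membership is tracked in the larger
  \<open>P\<close>.\<close>

lemma condition_K_imp_hcomp_mem:
  assumes K: "condition_K E" and "x \<in> P"
  shows "hcomp n x \<in> P"
proof -
  interpret J: graded_lpa_ideal E graded_part
    by (rule graded_part_ideal)
  have JP: "y \<in> P" if "y \<in> graded_part" for y
    using that graded_part_subset by blast
  have "x \<in> graded_part"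
  proof (rule ccontr)
    assume xJ: "x \<notin> graded_part"
    have x: "x \<in> F0"
      using assms(2) subset by blast
    obtain d where d: "x \<in> J.normal_span d"
      using J.exists_normal_span[OF x] by blast
    obtain b p w F where b: "b \<in> F1" and p: "p \<in> path_algebra" and w: "w \<in> verts E"
      and *: "finite F \<and> F \<subseteq> out_arcs E w \<and> J.cong (x * b) (p * gap w F) \<and> p * gap w F \<notin> graded_part \<and>
        (F = {} \<or> (\<forall>e\<in>arcs E. gap w F * ed e \<in> graded_part))"
      using J.reduction[OF d x xJ] by (elim bexE exE) (rule that)
    note F = conjunct1[OF *] conjunct1[OF conjunct2[OF *]]
    let ?z = "gap w F"
    have z: "?z \<in> F1"
      by (rule gap_free(2)[OF w F(2)])
    have xb: "J.cong (x * b) (p * ?z)" and pz: "p * ?z \<notin> graded_part"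
      and sink: "F = {} \<or> (\<forall>e\<in>arcs E. ?z * ed e \<in> graded_part)"
      using * by simp_all
    obtain T k where T: "finite T" "\<forall>\<alpha>\<in>T. set \<alpha> \<subseteq> arcs E"
      and p_eq: "p = (\<Sum>\<alpha>\<in>T. scalar (k \<alpha>) * path \<alpha>)"
      using path_algebra_sum[OF p] .
    let ?t = "\<lambda>\<alpha>. scalar (k \<alpha>) * path \<alpha> * ?z"
    \<comment> \<open>Terms already in the graded part are discarded before a shortest path is
      chosen, so that the chosen one is a walk into \<open>w\<close>.\<close>
    define T' where "T' = {\<alpha>\<in>T. ?t \<alpha> \<notin> graded_part}"
    have T': "finite T'" "T' \<subseteq> T"
      using T(1) by (auto simp: T'_def)
    have "T' \<noteq> {}"
      using J.path_sum_not_mem[OF pz[unfolded p_eq]] unfolding T'_def by blast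
    then obtain \<alpha>0 where \<alpha>0: "\<alpha>0 \<in> T'" "\<And>\<alpha>. \<alpha> \<in> T' \<Longrightarrow> length \<alpha>0 \<le> length \<alpha>"
      using arg_min_if_finite(1)[OF T'(1)] arg_min_least[OF T'(1)] by metis
    \<comment> \<open>A bound for the lengths of all paths in \<open>T'\<close>, hence for what
      remains of them after \<open>\<alpha>0\<close> is stripped off.\<close>
    define m where "m = Max (length ` T')"
    have m: "length \<alpha> \<le> m" if "\<alpha> \<in> T'" for \<alpha>
      using that T'(1) by (simp add: m_def)
    have k0: "k \<alpha>0 \<noteq> 0" and z0: "path \<alpha>0 * ?z \<notin> graded_part"
      using \<alpha>0(1) J.term_not_memD unfolding T'_def by blast+
    have arcs: "set \<alpha> \<subseteq> arcs E" if "\<alpha> \<in> T'" for \<alpha>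
      using that T T' by (meson subsetD)
    have zJ: "?z \<notin> graded_part"
      using z0 J.left_mem arcs[OF \<alpha>0(1)] by blast
    obtain u where u: "awalk u \<alpha>0 w"
      using J.path_gap_not_mem_imp_awalk[OF w F(2) arcs[OF \<alpha>0(1)] z0] .
    obtain a c where a: "a \<in> F1" and c: "c \<in> F1" and acz: "J.cong (a * vx w * ?z * c) ?z"
      and kill: "\<And>q. q \<noteq> [] \<Longrightarrow> set q \<subseteq> arcs E \<Longrightarrow> length q \<le> m \<Longrightarrow>
        a * vx w * path q * ?z * c \<in> graded_part"
      by (rule J.gap_conjugation[OF K w F sink, of m]) blast
    let ?G = "a * (vx w * ghost_path \<alpha>0)"
    have G: "?G \<in> F1"
      using a w arcs[OF \<alpha>0(1)] by auto
    have shift: "J.cong (?G * (path \<alpha>0 * y)) (a * vx w * y)" if "y \<in> F1" for y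
    proof -
      have "J.cong (a * (vx w * ghost_path \<alpha>0 * path \<alpha>0) * y) (a * vx w * y)"
        by (rule J.cong_mid[OF J.ghost_path_path[OF u] a that])
      then show ?thesis
        by (simp add: mult.assoc)
    qed
    have term_eq: "?G * ?t \<alpha> * c = scalar (k \<alpha>) * (?G * (path \<alpha> * (?z * c)))" for \<alpha>
    proof -
      have "?G * ?t \<alpha> * c = (?G * scalar (k \<alpha>)) * (path \<alpha> * (?z * c))"
        by (simp only: mult.assoc)
      also have "\<dots> = (scalar (k \<alpha>) * ?G) * (path \<alpha> * (?z * c))"
        by (simp only: scalar_commute[of "k \<alpha>" ?G])
      finally show ?thesis
        by (simp only: mult.assoc)
    qed
    have zc: "?z * c \<in> F1"
      using z c by auto
    have term_cong: "J.cong (?G * ?t \<alpha> * c) (if \<alpha> = \<alpha>0 then scalar (k \<alpha>) * ?z else 0)" if "\<alpha> \<in> T'" for \<alpha>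
    proof (cases "\<alpha> = \<alpha>0")
      case True
      have "J.cong (?G * (path \<alpha>0 * (?z * c))) (a * vx w * (?z * c))"
        by (rule shift[OF zc])
      also have "a * vx w * (?z * c) = a * vx w * ?z * c"
        by (simp only: mult.assoc)
      also note acz
      finally have "J.cong (scalar (k \<alpha>0) * (?G * (path \<alpha>0 * (?z * c)))) (scalar (k \<alpha>0) * ?z)"
        by (rule J.cong_left) auto
      then show ?thesis
        unfolding term_eq using True by simp
    next
      case False
      \<comment> \<open>Either \<open>\<alpha>\<close> extends \<open>\<alpha>0\<close>, and the
        nonempty remainder is destroyed by \<open>a\<close> and \<open>c\<close>; or the ghost of
        \<open>\<alpha>0\<close> kills it, as \<open>\<alpha>0\<close> is no longer than
        \<open>\<alpha>\<close>.\<close>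
      have "?G * (path \<alpha> * (?z * c)) \<in> graded_part"
      proof (cases "\<exists>q. \<alpha> = \<alpha>0 @ q")
        case True
        then obtain q where q: "\<alpha> = \<alpha>0 @ q"
          by blast
        then have "q \<noteq> []" "set q \<subseteq> arcs E" "length q \<le> m"
          using False arcs[OF that] m[OF that] by auto
        then have "a * vx w * path q * ?z * c \<in> graded_part" and "path q * (?z * c) \<in> F1"
          using kill zc by auto
        then show ?thesis
          using J.cong_mem_iff[OF shift[of "path q * (?z * c)"]] by (simp add: q path_append mult.assoc)
      next
        case False
        then have "ghost_path \<alpha>0 * path \<alpha> \<in> graded_part"
          using \<alpha>0 arcs that by (intro J.ghost_path_path_diff) auto
        then have "(a * vx w) * (ghost_path \<alpha>0 * path \<alpha>) * (?z * c) \<in> graded_part"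
          using a w zc by - (rule J.right_mem[OF J.left_mem], auto)
        then show ?thesis
          by (simp add: mult.assoc)
      qed
      then have "scalar (k \<alpha>) * (?G * (path \<alpha> * (?z * c))) \<in> graded_part"
        by (rule J.left_mem) auto
      then show ?thesis
        unfolding term_eq using False by simp
    qed
    have cancel: "y - (y - y') = y'" for y y' :: "(('v, 'e) lpa_gen, 'k) free_poly"
      by simp
    \<comment> \<open>From here the congruences are read modulo \<open>P\<close>: membership passes
      from \<open>x * b\<close> to \<open>p * ?z\<close>, to the sum over \<open>T'\<close>, and to
      the one multiple of \<open>?z\<close> left after compression.\<close>
    have "x * b \<in> P"
      using assms(2) b by (rule right_mem)
    moreover have "x * b - p * ?z \<in> P"
      using xb JP unfolding J.cong_def by blast
    ultimately have "x * b - (x * b - p * ?z) \<in> P"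
      by (rule diff_mem)
    then have "sum ?t T \<in> P"
      unfolding cancel p_eq sum_distrib_right .
    moreover have "sum ?t (T - T') \<in> P"
      by (intro sum_mem JP) (simp add: T'_def)
    ultimately have "sum ?t T - sum ?t (T - T') \<in> P"
      by (rule diff_mem)
    then have "sum ?t T' \<in> P"
      unfolding sum.subset_diff[OF T'(2) T(1)] add_diff_cancel_left' .
    then have "?G * sum ?t T' * c \<in> P"
      by (rule right_mem[OF left_mem[OF _ G] c])
    moreover have "?G * sum ?t T' * c - scalar (k \<alpha>0) * ?z \<in> P"
    proof (rule JP)
      have "J.cong (\<Sum>\<alpha>\<in>T'. ?G * ?t \<alpha> * c) (\<Sum>\<alpha>\<in>T'. if \<alpha> = \<alpha>0 then scalar (k \<alpha>) * ?z else 0)"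
        by (rule J.cong_sum[OF term_cong])
      also have "(\<Sum>\<alpha>\<in>T'. if \<alpha> = \<alpha>0 then scalar (k \<alpha>) * ?z else 0) = scalar (k \<alpha>0) * ?z"
        using T'(1) \<alpha>0(1) by simp
      finally show "?G * sum ?t T' * c - scalar (k \<alpha>0) * ?z \<in> graded_part"
        unfolding J.cong_def sum_distrib_left sum_distrib_right .
    qed
    ultimately have "?G * sum ?t T' * c - (?G * sum ?t T' * c - scalar (k \<alpha>0) * ?z) \<in> P"
      by (rule diff_mem)
    then have "scalar (k \<alpha>0) * ?z \<in> P"
      unfolding cancel .
    then have "?z \<in> P"
      using k0 by (rule unscale_mem)
    then show False
      using zJ homogeneous_mem_graded_part[OF _ homogeneous_gap] by blast
  qed
  then show ?thesis
    by (simp add: graded_part_def)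
qed

end


section \<open>The Leavitt path algebra as a quotient\<close>

lemma free_algebra_simps [simp]:
  "mult (free_algebra X) = (*)" "zero (free_algebra X) = 0" "add (free_algebra X) = (+)"
  "smult (free_algebra X) k x = scalar k * x"
  by (simp_all add: free_algebra_def)

lemma free_algebra_minus:
  assumes "x \<in> nonunital_free X"
  shows "m_inv (add_monoid (free_algebra X)) x = - x"
  unfolding m_inv_def using assms by (intro the_equality) (auto simp: eq_neg_iff_add_eq_0)

lemma algebra_ideal_iff_free_ideal: "algebra_ideal P (free_algebra X) \<longleftrightarrow> free_ideal X P"
proof
  assume P: "algebra_ideal P (free_algebra X)"
  then interpret additive_subgroup P "free_algebra X"
    by (simp add: algebra_ideal_def two_sided_ideal_def)
  show "free_ideal X P"
  proof (rule free_idealI)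
    show "P \<subseteq> nonunital_free X"
      by (rule a_subset)
    show "0 \<in> P"
      using zero_closed by simp
    show "x + y \<in> P" if "x \<in> P" "y \<in> P" for x y
      using a_closed[OF that] by simp
    show "scalar c * x \<in> P" if "x \<in> P" for x c
      using P that by (simp add: algebra_ideal_def)
    show "gen g * x \<in> P" "x * gen g \<in> P" if "x \<in> P" "g \<in> X" for x g
      using P that by (simp_all add: algebra_ideal_def two_sided_ideal_def)
  qed
next
  assume "free_ideal X P"
  then interpret free_ideal X P .
  have "additive_subgroup P (free_algebra X)"
  proof (intro additive_subgroup.intro subgroup.intro)
    show "m_inv (add_monoid (free_algebra X)) x \<in> P" if "x \<in> P" for x
      unfolding free_algebra_minus[OF subsetD[OF subset that]] using that by (rule uminus_mem)
  qed (use subset in \<open>auto intro: add_mem\<close>)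
  then show "algebra_ideal P (free_algebra X)"
    by (auto simp: algebra_ideal_def two_sided_ideal_def intro: left_mem right_mem nonunital_imp_unital)
qed

locale leavitt = wf_digraph E
  for E :: "('v, 'e) pre_digraph" and K :: "'k::field itself"
begin

abbreviation "L \<equiv> leavitt_path_algebra K E"
abbreviation "free0 \<equiv> nonunital_free (lpa_gens E) :: (('v, 'e) lpa_gen, 'k) free_poly set"
abbreviation "cl \<equiv> lpa_class E :: (('v, 'e) lpa_gen, 'k) free_poly \<Rightarrow> _"
abbreviation "rel_ideal \<equiv> lpa_relation_ideal E :: (('v, 'e) lpa_gen, 'k) free_poly set"

lemma lpa_relations_subset: "(lpa_relations E :: (('v, 'e) lpa_gen, 'k) free_poly set) \<subseteq> free0"
proof
  fix x :: "(('v, 'e) lpa_gen, 'k) free_poly"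
  assume "x \<in> lpa_relations E"
  then show "x \<in> free0"
    by (induction rule: lpa_relations.induct)
      (auto intro!: nonunital_free_intros nonunital_free_sum nonunital_imp_unital
        simp: lpa_gens_def regular_vertex_def)
qed

lemma rel_ideal_lpa_ideal: "lpa_ideal E rel_ideal"
proof -
  let ?\<I> = "{I :: (('v, 'e) lpa_gen, 'k) free_poly set. free_ideal (lpa_gens E) I \<and> lpa_relations E \<subseteq> I}"
  have eq: "rel_ideal = \<Inter> ?\<I>"
    by (simp add: lpa_relation_ideal_def algebra_ideal_iff_free_ideal)
  \<comment> \<open>One member inside \<open>free0\<close> is needed to bound the
    intersection.\<close>
  have mem: "free0 \<in> ?\<I>"
    using lpa_relations_subset by (auto intro!: free_ideal.intro intro: nonunital_free_intros)
  have "free_ideal (lpa_gens E) rel_ideal"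
  proof
    show "rel_ideal \<subseteq> free0"
      unfolding eq using mem by blast
  qed (auto simp: eq intro: free_ideal.zero_mem free_ideal.add_mem free_ideal.left_mem free_ideal.right_mem)
  moreover have "lpa_relations E \<subseteq> rel_ideal"
    unfolding eq by blast
  ultimately show ?thesis
    by (intro lpa_ideal.intro lpa_ideal_axioms.intro wf_digraph_axioms)
qed

sublocale R: lpa_ideal E rel_ideal
  by (rule rel_ideal_lpa_ideal)

lemma rel_ideal_least: "lpa_ideal E P \<Longrightarrow> rel_ideal \<subseteq> P"
  unfolding lpa_relation_ideal_def lpa_ideal_def lpa_ideal_axioms_def algebra_ideal_iff_free_ideal
  by blast

lemma cl_def: "cl x = (\<lambda>i. i + x) ` rel_ideal"
  by (auto simp: lpa_class_def a_r_coset_def')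

lemma cl_eq_iff: "cl x = cl y \<longleftrightarrow> x - y \<in> rel_ideal"
proof
  assume "cl x = cl y"
  moreover have "x \<in> cl x"
    unfolding cl_def by (rule image_eqI[of _ _ 0]) auto
  ultimately show "x - y \<in> rel_ideal"
    by (auto simp: cl_def)
next
  have sub: "cl x \<subseteq> cl y" if "x - y \<in> rel_ideal" for x y
    unfolding cl_def
  proof clarify
    fix i assume "i \<in> rel_ideal"
    then show "i + x \<in> (\<lambda>i. i + y) ` rel_ideal"
      using R.add_mem[OF _ that] by (intro image_eqI[of _ _ "i + (x - y)"]) auto
  qed
  assume "x - y \<in> rel_ideal"
  then show "cl x = cl y"
    using sub[of x y] sub[of y x] R.uminus_mem[of "x - y"] by auto
qed

lemma cl_0: "cl 0 = rel_ideal"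
  by (simp add: cl_def)

lemma carrier_L: "carrier L = cl ` free0"
  by (auto simp: leavitt_path_algebra_def Let_def A_RCOSETS_def' lpa_class_def)

lemma cl_carrier: "x \<in> free0 \<Longrightarrow> cl x \<in> carrier L"
  by (simp add: carrier_L)

lemma zero_L: "zero L = cl 0"
  by (simp add: leavitt_path_algebra_def Let_def cl_0)

lemma add_L: "cl x \<oplus>\<^bsub>L\<^esub> cl y = cl (x + y)"
proof -
  have "cl x \<oplus>\<^bsub>L\<^esub> cl y = {i + x + (j + y) |i j. i \<in> rel_ideal \<and> j \<in> rel_ideal}"
    by (auto simp: leavitt_path_algebra_def Let_def set_add_def' cl_def)
  also have "\<dots> = cl (x + y)"
  proof (intro equalityI subsetI)
    fix z assume "z \<in> {i + x + (j + y) |i j. i \<in> rel_ideal \<and> j \<in> rel_ideal}"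
    then obtain i j where "i \<in> rel_ideal" "j \<in> rel_ideal" "z = (i + j) + (x + y)"
      by (auto simp: algebra_simps)
    then show "z \<in> cl (x + y)"
      unfolding cl_def using R.add_mem by blast
  next
    fix z assume "z \<in> cl (x + y)"
    then obtain i where "i \<in> rel_ideal" "z = i + x + (0 + y)"
      by (auto simp: cl_def algebra_simps)
    then show "z \<in> {i + x + (j + y) |i j. i \<in> rel_ideal \<and> j \<in> rel_ideal}"
      using R.zero_mem by blast
  qed
  finally show ?thesis .
qed

lemma mult_L:
  assumes "x \<in> free0" "y \<in> free0"
  shows "cl x \<otimes>\<^bsub>L\<^esub> cl y = cl (x * y)"
proof -
  have "cl ((i + x) * (j + y)) = cl (x * y)" if "i \<in> rel_ideal" "j \<in> rel_ideal" for i j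
  proof -
    have "j + y \<in> free0"
      using that assms R.subset by auto
    then have "i * (j + y) + x * j \<in> rel_ideal"
      using that assms by (intro R.add_mem R.right_mem R.left_mem nonunital_imp_unital)
    then show ?thesis
      by (simp add: cl_eq_iff algebra_simps)
  qed
  then have "(\<Union>a\<in>cl x. \<Union>b\<in>cl y. cl (a * b)) = cl (x * y)"
    using R.zero_mem unfolding cl_def[of x] cl_def[of y] by auto
  moreover have "cl x \<otimes>\<^bsub>L\<^esub> cl y = (\<Union>a\<in>cl x. \<Union>b\<in>cl y. cl (a * b))"
    by (simp add: leavitt_path_algebra_def Let_def rcoset_mult_def lpa_class_def)
  ultimately show ?thesis
    by simp
qed

sublocale L: abelian_group L
proof (rule abelian_groupI)
  fix X Y Z assume "X \<in> carrier L" "Y \<in> carrier L" "Z \<in> carrier L"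
  then obtain x y z where eq: "x \<in> free0" "X = cl x" "y \<in> free0" "Y = cl y" "Z = cl z"
    by (auto simp: carrier_L)
  then show "X \<oplus>\<^bsub>L\<^esub> Y \<in> carrier L" "X \<oplus>\<^bsub>L\<^esub> Y \<oplus>\<^bsub>L\<^esub> Z = X \<oplus>\<^bsub>L\<^esub> (Y \<oplus>\<^bsub>L\<^esub> Z)"
    "X \<oplus>\<^bsub>L\<^esub> Y = Y \<oplus>\<^bsub>L\<^esub> X" "\<zero>\<^bsub>L\<^esub> \<oplus>\<^bsub>L\<^esub> X = X"
    by (auto simp: add_L zero_L carrier_L algebra_simps)
  have "cl (- x) \<in> carrier L" "cl (- x) \<oplus>\<^bsub>L\<^esub> X = \<zero>\<^bsub>L\<^esub>"
    using eq by (simp_all add: add_L zero_L cl_carrier)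
  then show "\<exists>Y\<in>carrier L. Y \<oplus>\<^bsub>L\<^esub> X = \<zero>\<^bsub>L\<^esub>"
    by blast
qed (simp add: zero_L cl_carrier)

lemma minus_L: "x \<in> free0 \<Longrightarrow> m_inv (add_monoid L) (cl x) = cl (- x)"
  using L.minus_equality[of "cl (- x)" "cl x", unfolded a_inv_def]
  by (simp only: add_L zero_L cl_carrier nonunital_free_intros add.left_inverse)

lemma finsum_L:
  "finite S \<Longrightarrow> (\<And>n. n \<in> S \<Longrightarrow> y n \<in> free0) \<Longrightarrow> (\<Oplus>\<^bsub>L\<^esub>n\<in>S. cl (y n)) = cl (sum y S)"
proof (induction S rule: finite_induct)
  case empty
  then show ?case by (simp add: zero_L)
next
  case (insert n S)
  then show ?case
    by (subst L.finsum_insert) (auto simp: add_L intro: cl_carrier)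
qed

section \<open>Ideals of the Leavitt path algebra and their preimages in the free algebra\<close>

definition preimage where
  "preimage P = {x \<in> free0. cl x \<in> P}"

text \<open>The point is stability under scalars, which a ring ideal does not assume: with a local
  unit \<open>u\<close> for \<open>x\<close>, the multiple of \<open>x\<close> by a scalar is
  congruent to \<open>x\<close> times that multiple of \<open>u\<close>, and the latter is an
  element of the algebra.\<close>

lemma preimage_lpa_ideal:
  assumes P: "two_sided_ideal P L"
  shows "lpa_ideal E (preimage P)"
proof -
  interpret P: additive_subgroup P L
    using P by (simp add: two_sided_ideal_def)
  have mult: "x * a \<in> preimage P" "a * x \<in> preimage P" if x: "x \<in> preimage P" and a: "a \<in> free0" for x a
  proof -
    have x0: "x \<in> free0" "cl x \<in> P"
      using x by (simp_all add: preimage_def)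
    have "cl x \<otimes>\<^bsub>L\<^esub> cl a \<in> P" "cl a \<otimes>\<^bsub>L\<^esub> cl x \<in> P"
      using P x0(2) cl_carrier[OF a] unfolding two_sided_ideal_def by simp_all
    then show "x * a \<in> preimage P" "a * x \<in> preimage P"
      using x0 a by (simp_all add: mult_L preimage_def nonunital_imp_unital)
  qed
  have eqv: "y \<in> preimage P" if "x \<in> preimage P" "y \<in> free0" "R.cong x y" for x y
    using that cl_eq_iff[of x y] by (simp add: preimage_def R.cong_def)
  have "free_ideal (lpa_gens E) (preimage P)"
  proof (rule free_idealI)
    show "0 \<in> preimage P"
      using P.zero_closed by (simp add: preimage_def zero_L)
    show "x + y \<in> preimage P" if "x \<in> preimage P" "y \<in> preimage P" for x y
      using that P.a_closed[of "cl x" "cl y"] by (auto simp: preimage_def add_L)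
    show "scalar c * x \<in> preimage P" if x: "x \<in> preimage P" for x c
    proof -
      have x0: "x \<in> free0"
        using x by (simp add: preimage_def)
      obtain A where A: "finite A" "A \<subseteq> verts E" "R.cong (x * (\<Sum>v\<in>A. vx v)) x"
        using R.local_unit[OF x0] .
      let ?u = "\<Sum>v\<in>A. vx v"
      have u: "scalar c * ?u \<in> free0"
        using A(2) by (intro nonunital_free_intros(6) nonunital_free_sum nonunital_free_intros(7)) auto
      have "x * (scalar c * ?u) = (x * scalar c) * ?u"
        by (simp only: mult.assoc)
      also have "\<dots> = (scalar c * x) * ?u"
        by (simp only: scalar_commute[of c x])
      also have "R.cong \<dots> (scalar c * x)"
        unfolding mult.assoc by (rule R.cong_left[OF A(3)]) auto
      finally show ?thesis
        by (rule eqv[OF mult(1)[OF x u] nonunital_free_intros(6)[OF unital_free_intros(3) x0]])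
    qed
    show "preimage P \<subseteq> free0"
      by (auto simp: preimage_def)
    show "gen g * x \<in> preimage P" "x * gen g \<in> preimage P" if "x \<in> preimage P" "g \<in> lpa_gens E" for x g
      using mult[OF that(1) nonunital_free_intros(7)[OF that(2)]] by simp_all
  qed
  moreover have "lpa_relations E \<subseteq> preimage P"
  proof
    fix x :: "(('v, 'e) lpa_gen, 'k) free_poly"
    assume x: "x \<in> lpa_relations E"
    have "x - 0 \<in> rel_ideal"
      using subsetD[OF R.relations x] by simp
    then have "cl x = cl 0"
      by (simp only: cl_eq_iff)
    then have "cl x \<in> P"
      using P.zero_closed by (simp only: zero_L)
    then show "x \<in> preimage P"
      using subsetD[OF lpa_relations_subset x] by (simp add: preimage_def)
  qed
  ultimately show ?thesis
    by (intro lpa_ideal.intro lpa_ideal_axioms.intro wf_digraph_axioms)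
qed

text \<open>\<open>P\<close> contains the relation ideal and is therefore a union of its
  cosets.\<close>

lemma cl_mem_image_iff:
  assumes "lpa_ideal E P"
  shows "cl x \<in> cl ` P \<longleftrightarrow> x \<in> P"
proof
  interpret P: lpa_ideal E P by fact
  assume "cl x \<in> cl ` P"
  then obtain y where y: "y \<in> P" "x - y \<in> rel_ideal"
    unfolding image_iff cl_eq_iff by blast
  then have "x - y \<in> P"
    using rel_ideal_least[OF assms] by blast
  then show "x \<in> P"
    using P.add_mem[OF _ y(1), of "x - y"] by simp
qed (rule imageI)

lemma image_two_sided_ideal:
  assumes "lpa_ideal E P"
  shows "two_sided_ideal (cl ` P) L"
proof -
  interpret P: lpa_ideal E P by fact
  have P0: "x \<in> free0" if "x \<in> P" for x
    using that P.subset by blast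
  have "additive_subgroup (cl ` P) L"
  proof (intro additive_subgroup.intro subgroup.intro)
    show "cl ` P \<subseteq> carrier (add_monoid L)"
      using P0 cl_carrier by (simp add: image_subset_iff)
    show "X \<otimes>\<^bsub>add_monoid L\<^esub> Y \<in> cl ` P" if XY: "X \<in> cl ` P" "Y \<in> cl ` P" for X Y
    proof -
      obtain x y where "x \<in> P" "X = cl x" "y \<in> P" "Y = cl y"
        using XY by blast
      then show ?thesis
        using imageI[OF P.add_mem, of x y cl] by (simp add: add_L)
    qed
    show "\<one>\<^bsub>add_monoid L\<^esub> \<in> cl ` P"
      using imageI[OF P.zero_mem, of cl] by (simp add: zero_L)
    show "m_inv (add_monoid L) X \<in> cl ` P" if X: "X \<in> cl ` P" for X
    proof -
      obtain x where x: "x \<in> P" "X = cl x"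
        using X by blast
      show ?thesis
        unfolding x(2) minus_L[OF P0[OF x(1)]] using P.uminus_mem[OF x(1)] by (rule imageI)
    qed
  qed
  moreover have "Y \<otimes>\<^bsub>L\<^esub> X \<in> cl ` P" "X \<otimes>\<^bsub>L\<^esub> Y \<in> cl ` P" if XY: "X \<in> cl ` P" "Y \<in> carrier L" for X Y
  proof -
    obtain x y where x: "x \<in> P" "X = cl x" and y: "y \<in> free0" "Y = cl y"
      using XY unfolding carrier_L by blast
    show "Y \<otimes>\<^bsub>L\<^esub> X \<in> cl ` P" "X \<otimes>\<^bsub>L\<^esub> Y \<in> cl ` P"
      unfolding x(2) y(2) mult_L[OF P0[OF x(1)] y(1)] mult_L[OF y(1) P0[OF x(1)]]
      using P.left_mem P.right_mem x(1) nonunital_imp_unital[OF y(1)] by blast+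
  qed
  ultimately show ?thesis
    by (simp add: two_sided_ideal_def)
qed

lemma mem_iff_preimage: "X \<in> carrier L \<Longrightarrow> X \<in> P \<longleftrightarrow> (\<exists>x\<in>preimage P. X = cl x)"
  by (auto simp: carrier_L preimage_def)

lemma cl_component: "x \<in> free0 \<Longrightarrow> homogeneous n x \<Longrightarrow> cl x \<in> lpa_component K E n"
  by (auto simp: lpa_component_def homogeneous_def)

lemma graded_ideal_L:
  assumes P: "two_sided_ideal P L" and hcomp: "\<And>x n. x \<in> preimage P \<Longrightarrow> hcomp n x \<in> preimage P"
  shows "graded_ideal (lpa_component K E) P L"
  unfolding graded_ideal_def
proof (intro conjI P ballI)
  fix X assume X: "X \<in> P"
  have "P \<subseteq> carrier L"
    using P by (simp add: two_sided_ideal_def additive_subgroup.a_subset)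
  then obtain x where x: "x \<in> preimage P" "X = cl x"
    using X mem_iff_preimage by blast
  let ?S = "word_degree ` Poly_Mapping.keys x"
  have *: "hcomp n x \<in> free0" "cl (hcomp n x) \<in> P" for n
    using hcomp[OF x(1), of n] by (simp_all add: preimage_def)
  have "X = cl (\<Sum>n\<in>?S. hcomp n x)"
    by (simp add: x(2) sum_hcomp)
  then have "X = (\<Oplus>\<^bsub>L\<^esub>n\<in>?S. cl (hcomp n x))"
    using * by (simp add: finsum_L)
  moreover have "cl (hcomp n x) \<in> P \<inter> lpa_component K E n" for n
    using * homogeneous_hcomp cl_component by blast
  ultimately show "\<exists>S c. finite S \<and> (\<forall>n\<in>S. c n \<in> P \<inter> lpa_component K E n) \<and> X = (\<Oplus>\<^bsub>L\<^esub>n\<in>S. c n)"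
    by (intro exI[of _ ?S] exI[of _ "\<lambda>n. cl (hcomp n x)"]) simp
qed

text \<open>Homogeneous summands in the quotient lift to homogeneous elements, but their sum agrees
  with \<open>x\<close> only up to the relation ideal. Components of that error stay in the ideal,
  because the relation ideal is graded.\<close>

lemma graded_ideal_hcomp_mem:
  assumes "graded_ideal (lpa_component K E) P L" "x \<in> preimage P"
  shows "hcomp n x \<in> preimage P"
proof -
  have P: "two_sided_ideal P L"
    using assms(1) by (simp add: graded_ideal_def)
  interpret Q: lpa_ideal E "preimage P"
    by (rule preimage_lpa_ideal[OF P])
  have "cl x \<in> P"
    using assms(2) by (simp add: preimage_def)
  then obtain S c where S: "finite S" "\<forall>m\<in>S. c m \<in> P \<inter> lpa_component K E m" "cl x = (\<Oplus>\<^bsub>L\<^esub>m\<in>S. c m)"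
    using assms(1) unfolding graded_ideal_def by meson
  have "\<forall>m\<in>S. \<exists>y. c m = cl y \<and> y \<in> free0 \<and> homogeneous m y"
    using S(2) by (auto simp: lpa_component_def homogeneous_def)
  then obtain y where y: "\<forall>m\<in>S. c m = cl (y m) \<and> y m \<in> free0 \<and> homogeneous m (y m)"
    by metis
  then have yP: "y m \<in> preimage P" if "m \<in> S" for m
    using that S(2) by (auto simp: preimage_def)
  have "(\<Oplus>\<^bsub>L\<^esub>m\<in>S. c m) = (\<Oplus>\<^bsub>L\<^esub>m\<in>S. cl (y m))"
    using y by (intro L.finsum_cong') (auto intro: cl_carrier)
  also have "\<dots> = cl (sum y S)"
    using y S(1) by (intro finsum_L) auto
  finally have "x - sum y S \<in> rel_ideal"
    using S(3) by (simp add: cl_eq_iff)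
  \<comment> \<open>Minimality gives the grading: the graded part of the relation ideal is again an
    ideal containing the relations.\<close>
  moreover have "rel_ideal \<subseteq> R.graded_part"
    using R.graded_part_ideal by (intro rel_ideal_least graded_lpa_ideal.axioms(1))
  ultimately have "hcomp n (x - sum y S) \<in> rel_ideal"
    by (auto simp: R.graded_part_def)
  then have "hcomp n x - (\<Sum>m\<in>S. hcomp n (y m)) \<in> preimage P"
    using rel_ideal_least[OF Q.lpa_ideal_axioms] by (auto simp: hcomp_diff hcomp_sum)
  moreover have "(\<Sum>m\<in>S. hcomp n (y m)) \<in> preimage P"
  proof (rule Q.sum_mem)
    fix m assume "m \<in> S"
    then have "hcomp n (y m) = (if n = m then y m else 0)" "y m \<in> preimage P"
      using y yP by (blast intro: hcomp_homogeneous)+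
    then show "hcomp n (y m) \<in> preimage P"
      by simp
  qed
  ultimately have "hcomp n x - (\<Sum>m\<in>S. hcomp n (y m)) + (\<Sum>m\<in>S. hcomp n (y m)) \<in> preimage P"
    by (rule Q.add_mem)
  then show ?thesis
    by simp
qed

lemma condition_K_imp_graded:
  assumes "condition_K E" "two_sided_ideal P L"
  shows "graded_ideal (lpa_component K E) P L"
  using assms
  by (intro graded_ideal_L lpa_ideal.condition_K_imp_hcomp_mem[OF preimage_lpa_ideal])

end


section \<open>The module of infinite paths\<close>

fun gen_act :: "('v, 'e) pre_digraph \<Rightarrow> ('v, 'e) lpa_gen \<Rightarrow> 'e stream \<Rightarrow> 'e stream option" where
  "gen_act E (Vertex w) p = (if tail E (shd p) = w then Some p else None)"
| "gen_act E (Edge e) p = (if head E e = tail E (shd p) then Some (e ## p) else None)"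
| "gen_act E (Ghost e) p = (if shd p = e then Some (stl p) else None)"

fun word_act :: "('v, 'e) pre_digraph \<Rightarrow> ('v, 'e) lpa_gen list \<Rightarrow> 'e stream \<Rightarrow> 'e stream option" where
  "word_act E [] p = Some p"
| "word_act E (g # ws) p = Option.bind (word_act E ws p) (gen_act E g)"

lemma word_act_append: "word_act E (us @ ws) p = Option.bind (word_act E ws p) (word_act E us)"
  by (induction us; cases "word_act E ws p"; simp)

text \<open>
  A word moves an infinite path or annihilates it, the last letter acting first. We use the
  transposed action on functions on infinite paths, a right module: it needs no finiteness.
\<close>

definition transpose_act ::
  "('v, 'e) pre_digraph \<Rightarrow> (('v, 'e) lpa_gen, 'k::field) free_poly \<Rightarrow> ('e stream \<Rightarrow> 'k) \<Rightarrow> 'e stream \<Rightarrow> 'k"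
  where "transpose_act E x f p = (\<Sum>w\<in>Poly_Mapping.keys x.
    Poly_Mapping.lookup x w * case_option 0 f (word_act E (letters w) p))"

lemma transpose_act_superset:
  assumes "finite A" "Poly_Mapping.keys x \<subseteq> A"
  shows "transpose_act E x f p =
    (\<Sum>w\<in>A. Poly_Mapping.lookup x w * case_option 0 f (word_act E (letters w) p))"
  unfolding transpose_act_def using assms by (intro sum.mono_neutral_left) (auto simp: in_keys_iff)

lemma transpose_act_0 [simp]: "transpose_act E 0 f p = 0"
  by (simp add: transpose_act_def)

lemma transpose_act_add: "transpose_act E (x + y) f p = transpose_act E x f p + transpose_act E y f p"
  and transpose_act_diff: "transpose_act E (x - y) f p = transpose_act E x f p - transpose_act E y f p"
proof -
  let ?A = "Poly_Mapping.keys x \<union> Poly_Mapping.keys y"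
  have A: "finite ?A" "Poly_Mapping.keys x \<subseteq> ?A" "Poly_Mapping.keys y \<subseteq> ?A"
    "Poly_Mapping.keys (x + y) \<subseteq> ?A" "Poly_Mapping.keys (x - y) \<subseteq> ?A"
    using keys_add[of x y] keys_minus_subset[of x y] by auto
  show "transpose_act E (x + y) f p = transpose_act E x f p + transpose_act E y f p"
    by (simp only: transpose_act_superset[OF A(1,2)] transpose_act_superset[OF A(1,3)]
        transpose_act_superset[OF A(1,4)] lookup_add distrib_right sum.distrib)
  show "transpose_act E (x - y) f p = transpose_act E x f p - transpose_act E y f p"
    by (simp only: transpose_act_superset[OF A(1,2)] transpose_act_superset[OF A(1,3)]
        transpose_act_superset[OF A(1,5)] lookup_minus left_diff_distrib sum_subtractf)
qed

lemma transpose_act_sum: "transpose_act E (sum x A) f p = (\<Sum>a\<in>A. transpose_act E (x a) f p)"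
  by (induction A rule: infinite_finite_induct) (simp_all add: transpose_act_add)

lemma transpose_act_single:
  "transpose_act E (Poly_Mapping.single w k) f p = k * case_option 0 f (word_act E (letters w) p)"
  by (simp add: transpose_act_def)

lemma transpose_act_mon: "transpose_act E (mon ws) f p = case_option 0 f (word_act E ws p)"
  by (simp add: mon_def transpose_act_single)

lemma transpose_act_gen: "transpose_act E (gen g) f p = case_option 0 f (gen_act E g p)"
  by (simp add: gen_eq_mon transpose_act_mon)

lemma transpose_act_fun_add:
  "transpose_act E x (\<lambda>q. f q + g q) p = transpose_act E x f p + transpose_act E x g p"
proof -
  have "case_option 0 (\<lambda>q. f q + g q) r = case_option 0 f r + case_option 0 g r" for r
    by (cases r) simp_all
  then show ?thesis
    by (simp add: transpose_act_def distrib_left sum.distrib)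
qed

lemma transpose_act_fun_0: "transpose_act E x (\<lambda>q. 0) p = 0"
  unfolding transpose_act_def by (intro sum.neutral) (auto split: option.split)

text \<open>Transposition reverses the order: \<open>y\<close> moves the path before
  \<open>x\<close> does, so \<open>x\<close> is applied to the function before
  \<open>y\<close>.\<close>

lemma transpose_act_mult: "transpose_act E (x * y) f p = transpose_act E y (transpose_act E x f) p"
proof -
  have "Poly_Mapping.keys x \<subseteq> UNIV"
    by simp
  then show ?thesis
  proof (induction x rule: poly_mapping_single_induct)
    case zero
    have "transpose_act E 0 f = (\<lambda>q. 0)"
      by (rule ext) simp
    then show ?case
      by (simp add: transpose_act_fun_0)
  next
    case (add x x')
    have "transpose_act E (x + x') f = (\<lambda>q. transpose_act E x f q + transpose_act E x' f q)"
      by (rule ext) (rule transpose_act_add)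
    then show ?case
      using add by (simp add: distrib_right transpose_act_add transpose_act_fun_add)
  next
    case (single u k)
    have "Poly_Mapping.keys y \<subseteq> UNIV"
      by simp
    then show ?case
    proof (induction y rule: poly_mapping_single_induct)
      case (single w l)
      show ?case
        by (cases "word_act E (letters w) p")
          (simp_all add: mult_single transpose_act_single word_act_append)
    qed (simp_all add: distrib_left transpose_act_add)
  qed
qed

text \<open>The value at \<open>p\<close> depends on \<open>f\<close> only at the finitely many
  paths to which words of \<open>x\<close> move \<open>p\<close>. This finiteness makes separation
  by a single word possible.\<close>

lemma transpose_act_cong:
  assumes "\<And>w q. w \<in> Poly_Mapping.keys x \<Longrightarrow> word_act E (letters w) p = Some q \<Longrightarrow> f q = g q"
  shows "transpose_act E x f p = transpose_act E x g p"
  unfolding transpose_act_def using assms by (intro sum.cong) (auto split: option.split)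

lemma transpose_act_scale:
  "transpose_act E x (\<lambda>q. f q * k) p = transpose_act E x f p * k"
proof -
  have "case_option 0 (\<lambda>q. f q * k) r = case_option 0 f r * k" for r
    by (cases r) simp_all
  then show ?thesis
    by (simp add: transpose_act_def sum_distrib_right mult.assoc)
qed

lemma transpose_act_fun_sum:
  "transpose_act E x (\<lambda>q. \<Sum>a\<in>A. f a q) p = (\<Sum>a\<in>A. transpose_act E x (f a) p)"
  by (induction A rule: infinite_finite_induct) (simp_all add: transpose_act_fun_0 transpose_act_fun_add)

lemma word_act_ghost: "word_act E (map Ghost (rev r)) (r @- s) = Some s"
  by (induction r) (simp_all add: word_act_append)

lemma word_act_ghost_Some:
  "word_act E (map Ghost (rev r)) q = Some s \<Longrightarrow> q = r @- s"
proof (induction r arbitrary: q)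
  case (Cons e r)
  then have "shd q = e" "word_act E (map Ghost (rev r)) (stl q) = Some s"
    by (auto simp: word_act_append split: if_splits)
  then show ?case
    using Cons.IH[of "stl q"] by (metis shift.simps(2) stream.collapse)
qed simp

text \<open>
  The infinite paths that end in \<open>ccc...\<close> are the basis of a Chen module. The only one of them
  that starts at \<open>v\<close> is \<open>ccc...\<close> itself.
\<close>

locale unique_closed_path = leavitt E K
  for E :: "('v, 'e) pre_digraph" and K :: "'k::field itself" +
  fixes v :: 'v and c :: "'e list"
  assumes c: "closed_simple_path E v c"
    and unique: "closed_simple_path E v p \<Longrightarrow> p = c"
begin

lemma c_walk: "awalk v c v" and c_ne: "c \<noteq> []"
  using c by (auto simp: closed_simple_path_def)

lemma c_cycle: "c @- Stream.cycle c = Stream.cycle c"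
  using cycle_decomp[OF c_ne] by simp

definition tails :: "'e stream set" where
  "tails = {q @- Stream.cycle c |u q. awalk u q v}"

text \<open>An empty \<open>q\<close> can be replaced by \<open>c\<close>, because prepending
  \<open>c\<close> does not change ccc...\<close>

lemma tailsE:
  assumes "p \<in> tails"
  obtains u q where "awalk u q v" "p = q @- Stream.cycle c" "q \<noteq> []"
proof -
  obtain u q where q: "awalk u q v" "p = q @- Stream.cycle c"
    using assms by (auto simp: tails_def)
  show ?thesis
  proof (cases "q = []")
    case True
    then show ?thesis
      using that[of v c] q c_walk c_ne c_cycle by simp
  qed (use that q in blast)
qed

lemma tailsI: "awalk u q v \<Longrightarrow> q @- Stream.cycle c \<in> tails"
  unfolding tails_def by blast

lemma cycle_tails: "Stream.cycle c \<in> tails"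
  using tailsI[of v "[]"] c_walk by (auto simp: awalk_Nil_iff)

lemma tail_shd:
  assumes "awalk u q v"
  shows "tail E (shd (q @- Stream.cycle c)) = u"
proof (cases q)
  case Nil
  have "tail E (hd c) = v"
    using c_walk c_ne by (cases c) (auto simp: awalk_Cons_iff)
  then show ?thesis
    using assms Nil c_ne c_cycle by (metis awalk_Nil_iff shift.simps(1) shift_simps(1))
next
  case (Cons e r)
  then show ?thesis using assms by (simp add: awalk_Cons_iff)
qed

lemma tails_step:
  assumes "p \<in> tails"
  shows "shd p \<in> arcs E" "stl p \<in> tails" "tail E (shd (stl p)) = head E (shd p)"
proof -
  obtain u q where q: "awalk u q v" "p = q @- Stream.cycle c" "q \<noteq> []"
    using tailsE[OF assms] .
  then obtain e r where r: "q = e # r"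
    by (cases q) auto
  then have "awalk (head E e) r v" "e \<in> arcs E"
    using q(1) by (simp_all add: awalk_Cons_iff)
  then show "shd p \<in> arcs E" "stl p \<in> tails" "tail E (shd (stl p)) = head E (shd p)"
    using tail_shd tailsI q(2) r by simp_all
qed

lemma tails_Cons:
  assumes "p \<in> tails" "e \<in> arcs E" "head E e = tail E (shd p)"
  shows "e ## p \<in> tails"
proof -
  obtain u q where q: "awalk u q v" "p = q @- Stream.cycle c"
    using tailsE[OF assms(1)] .
  then have "awalk (tail E e) (e # q) v"
    using assms tail_shd[OF q(1)] by (simp add: awalk_Cons_iff)
  then show ?thesis
    using tailsI[of _ "e # q"] q(2) by simp
qed

lemma gen_act_tails:
  "p \<in> tails \<Longrightarrow> g \<in> lpa_gens E \<Longrightarrow> gen_act E g p = Some q \<Longrightarrow> q \<in> tails"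
  by (cases g) (auto intro: tails_Cons tails_step split: if_splits)

text \<open>The initial segment is a closed walk at \<open>v\<close>, hence a concatenation of
  closed simple paths; all of them are \<open>c\<close>, and ccc... absorbs them.\<close>

lemma tails_from_base:
  assumes "p \<in> tails" "tail E (shd p) = v"
  shows "p = Stream.cycle c"
proof -
  obtain u q where q: "awalk u q v" "p = q @- Stream.cycle c"
    using tailsE[OF assms(1)] .
  then have "awalk v q v"
    using assms(2) tail_shd by simp
  then obtain cs where cs: "q = concat cs" "\<forall>d\<in>set cs. closed_simple_path E v d"
    using closed_walk_concat by blast
  have "concat ds @- Stream.cycle c = Stream.cycle c" if "\<forall>d\<in>set ds. d = c" for ds
    using that by (induction ds) (simp_all add: c_cycle)
  then show ?thesis
    using cs q(2) unique by blast
qed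

lemma word_act_path:
  assumes "awalk u q v"
  shows "word_act E (map Edge q) (Stream.cycle c) = Some (q @- Stream.cycle c)"
  using assms
proof (induction q arbitrary: u)
  case (Cons e q)
  then have "awalk (head E e) q v"
    by (simp add: awalk_Cons_iff)
  then show ?case
    using Cons.IH tail_shd by simp
qed simp

text \<open>The last edge of \<open>q\<close> acts first; it ends at \<open>v\<close> and cannot be
  put in front of a path that starts elsewhere.\<close>

lemma word_act_path_None:
  assumes "awalk u q v" "q \<noteq> []" "tail E (shd p) \<noteq> v"
  shows "word_act E (map Edge q) p = None"
  using assms(1,2)
proof (induction q arbitrary: u)
  case (Cons e q)
  then have "awalk (head E e) q v"
    by (simp add: awalk_Cons_iff)
  then show ?case
    using Cons.IH assms(3) by (cases "q = []") (auto simp: awalk_Nil_iff)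
qed simp

text \<open>Functions separate finite combinations of paths, so vanishing for all \<open>f\<close>
  at all \<open>p\<close> in \<open>tails\<close> means annihilating the Chen module itself.\<close>

definition annihilator :: "(('v, 'e) lpa_gen, 'k) free_poly set" where
  "annihilator = {x \<in> free0. \<forall>f. \<forall>p\<in>tails. transpose_act E x f p = 0}"

text \<open>\<open>range_ghost\<close> and \<open>CK2\<close> are where membership in
  \<open>tails\<close> enters: the former needs consecutive edges to fit, the latter that a path
  leaving \<open>w\<close> starts with exactly one edge of \<open>out_arcs E w\<close>.\<close>

lemma relation_annihilates:
  assumes "x \<in> lpa_relations E" "p \<in> tails"
  shows "transpose_act E x f p = 0"
  using assms(1)
proof (induction rule: lpa_relations.induct)
  case (range_ghost e)
  then show ?case
    using tails_step[OF assms(2)]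
    by (auto simp: transpose_act_diff transpose_act_mult transpose_act_gen)
next
  case (CK2 w)
  have "transpose_act E (\<Sum>e\<in>out_arcs E w. ed e * gh e) f p = (\<Sum>e\<in>out_arcs E w. if e = shd p then f p else 0)"
    unfolding transpose_act_sum using tails_step[OF assms(2)]
    by (intro sum.cong) (auto simp: transpose_act_mult transpose_act_gen)
  also have "\<dots> = (if tail E (shd p) = w then f p else 0)"
    using CK2 tails_step(1)[OF assms(2)] by (auto simp: regular_vertex_def sum.delta)
  finally show ?case
    by (simp add: transpose_act_diff transpose_act_gen)
qed (simp_all add: transpose_act_diff transpose_act_mult transpose_act_gen)

lemma annihilator_lpa_ideal: "lpa_ideal E annihilator"
proof -
  have "free_ideal (lpa_gens E) annihilator"
  proof (rule free_idealI)
    show "annihilator \<subseteq> free0"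
      by (auto simp: annihilator_def)
    show "0 \<in> annihilator"
      by (simp add: annihilator_def)
    show "x + y \<in> annihilator" if "x \<in> annihilator" "y \<in> annihilator" for x y
      using that by (simp add: annihilator_def transpose_act_add)
    show "scalar k * x \<in> annihilator" if "x \<in> annihilator" for x k
      using that nonunital_free_intros(6)[OF unital_free_intros(3)]
      by (simp add: annihilator_def transpose_act_mult)
    show "gen g * x \<in> annihilator" if "x \<in> annihilator" "g \<in> lpa_gens E" for x g
      using that nonunital_free_intros(6)[OF unital_free_intros(7)]
      by (simp add: annihilator_def transpose_act_mult)
    show "x * gen g \<in> annihilator" if "x \<in> annihilator" "g \<in> lpa_gens E" for x g
      using that nonunital_free_intros(5)[OF _ unital_free_intros(7)] gen_act_tails
      by (auto simp: annihilator_def transpose_act_mult transpose_act_gen split: option.split)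
  qed
  moreover have "lpa_relations E \<subseteq> annihilator"
    using relation_annihilates lpa_relations_subset by (auto simp: annihilator_def)
  ultimately show ?thesis
    by (intro lpa_ideal.intro lpa_ideal_axioms.intro wf_digraph_axioms)
qed

section \<open>Two elements that detect the failure of gradedness\<close>

lemma v_verts: "v \<in> verts E"
  using c_walk by auto

lemma v_not_annihilates: "vx v \<notin> annihilator"
proof
  assume "vx v \<in> annihilator"
  then have "transpose_act E (vx v) (\<lambda>_. 1 :: 'k) (Stream.cycle c) = 0"
    using cycle_tails by (simp add: annihilator_def)
  moreover have "tail E (shd (Stream.cycle c)) = v"
    using tail_shd[of v "[]"] v_verts by (simp add: awalk_Nil_iff)
  ultimately show False
    by (simp add: transpose_act_gen)
qed

text \<open>On the only path starting at \<open>v\<close> both \<open>path c\<close> and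
  \<open>vx v\<close> act as the identity; on all others both act as zero.\<close>

lemma c_minus_v_annihilates: "path c - vx v \<in> annihilator"
proof -
  have "set c \<subseteq> arcs E"
    using c_walk by auto
  then have "path c \<in> free0"
    unfolding path_def using c_ne by (intro nonunital_free_intros(8)) auto
  moreover have "vx v \<in> free0"
    using v_verts by (intro nonunital_free_intros(7)) simp
  moreover have "transpose_act E (path c - vx v) f p = 0" if "p \<in> tails" for f :: "'e stream \<Rightarrow> 'k" and p
  proof (cases "tail E (shd p) = v")
    case True
    then have "p = Stream.cycle c"
      by (rule tails_from_base[OF that])
    then show ?thesis
      using True word_act_path[OF c_walk] c_cycle
      by (simp add: transpose_act_diff path_def transpose_act_mon transpose_act_gen)
  next
    case False
    then show ?thesis
      using word_act_path_None[OF c_walk c_ne False]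
      by (simp add: transpose_act_diff path_def transpose_act_mon transpose_act_gen)
  qed
  ultimately show ?thesis
    by (simp add: annihilator_def nonunital_free_intros(3))
qed

text \<open>A transitivity statement behind simplicity: the ghosts strip off an initial segment of
  \<open>q0\<close> long enough to differ from all other members of \<open>Q\<close>, which they
  thereby kill; ccc... remains, and the edges of \<open>b\<close> lead on to
  \<open>p0\<close>.\<close>

lemma separating_word:
  assumes "finite Q" "q0 \<in> tails" "p0 \<in> tails"
  obtains ws where "ws \<noteq> []" "set ws \<subseteq> lpa_gens E" "word_act E ws q0 = Some p0"
    "\<forall>q\<in>Q. q \<noteq> q0 \<longrightarrow> word_act E ws q = None"
proof -
  obtain u a where a: "awalk u a v" "q0 = a @- Stream.cycle c"
    using tailsE[OF assms(2)] .
  obtain u' b where b: "awalk u' b v" "p0 = b @- Stream.cycle c"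
    using tailsE[OF assms(3)] .
  have "\<exists>i. q !! i \<noteq> q0 !! i" if "q \<noteq> q0" for q
    using that smap_alt[of id q q0] by (simp add: stream.map_id)
  then have "\<forall>q\<in>Q - {q0}. \<exists>i. q !! i \<noteq> q0 !! i"
    by blast
  then obtain i where i: "\<forall>q\<in>Q - {q0}. q !! i q \<noteq> q0 !! i q"
    by metis
  \<comment> \<open>The sum dominates every single index of disagreement, so the first
    \<open>m\<close> entries tell \<open>q0\<close> from the whole of \<open>Q\<close>. The
    successor keeps the word nonempty even if there is nothing to separate.\<close>
  define m where "m = Suc (sum i (Q - {q0}))"
  \<comment> \<open>Powers of \<open>c\<close> make the segment arbitrarily long and let it end at
    \<open>v\<close>.\<close>
  define r where "r = a @ concat (replicate m c)"
  have r_walk: "awalk u r v"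
    unfolding r_def using a(1) awalk_concat_replicate[OF c_walk] by (rule awalk_appendI)
  have q0: "q0 = r @- Stream.cycle c"
    unfolding r_def a(2) by (induction m) (simp_all add: c_cycle)
  have "m \<le> m * length c"
    using c_ne by (cases c) simp_all
  then have r_len: "m \<le> length r"
    unfolding r_def by (simp add: length_concat sum_list_replicate trans_le_add2)
  let ?ws = "map Edge b @ map Ghost (rev r)"
  show ?thesis
  proof (rule that[of ?ws])
    show "?ws \<noteq> []"
      using r_len by (auto simp: m_def)
    have "set r \<subseteq> arcs E" "set b \<subseteq> arcs E"
      using r_walk b(1) by auto
    then show "set ?ws \<subseteq> lpa_gens E"
      by auto
    show "word_act E ?ws q0 = Some p0"
      using word_act_path[OF b(1)] by (simp add: word_act_append q0 word_act_ghost b(2))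
    show "\<forall>q\<in>Q. q \<noteq> q0 \<longrightarrow> word_act E ?ws q = None"
    proof (intro ballI impI)
      fix q assume q: "q \<in> Q" "q \<noteq> q0"
      have "word_act E (map Ghost (rev r)) q = None"
      proof (rule ccontr)
        assume "word_act E (map Ghost (rev r)) q \<noteq> None"
        then obtain s where s: "q = r @- s"
          using word_act_ghost_Some by blast
        have "i q \<le> sum i (Q - {q0})"
          using q assms(1) by (intro member_le_sum) auto
        then have "i q < length r"
          using r_len by (simp add: m_def)
        then have "q !! i q = q0 !! i q"
          by (simp add: s q0)
        then show False
          using i q by blast
      qed
      then show "word_act E ?ws q = None"
        by (simp add: word_act_append)
    qed
  qed
qed

text \<open>\<open>b\<close> sends \<open>p\<close> to a combination of paths with a nonzero
  coefficient at some \<open>q0\<close>. A word that moves \<open>q0\<close> to \<open>p0\<close>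
  and kills the other paths turns it into a nonzero multiple of \<open>p0\<close>, and
  \<open>a\<close> does not vanish there.\<close>

lemma annihilator_prime_free:
  assumes a: "a \<in> free0" "a \<notin> annihilator" and b: "b \<in> free0" "b \<notin> annihilator"
  obtains y where "y \<in> free0" "a * (y * b) \<notin> annihilator"
proof -
  obtain f0 p0 where p0: "p0 \<in> tails" "transpose_act E a f0 p0 \<noteq> 0"
    using a by (auto simp: annihilator_def)
  obtain f p where p: "p \<in> tails" "transpose_act E b f p \<noteq> 0"
    using b by (auto simp: annihilator_def)
  define \<psi> where "\<psi> = transpose_act E a f0"
  define Q where "Q = {q. \<exists>w\<in>Poly_Mapping.keys b. word_act E (letters w) p = Some q}"
  have "Q \<subseteq> (\<lambda>w. the (word_act E (letters w) p)) ` Poly_Mapping.keys b"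
    by (force simp: Q_def)
  then have Q: "finite Q"
    by (rule finite_subset) simp
  have word_tails: "q \<in> tails" if "word_act E ws p = Some q" "set ws \<subseteq> lpa_gens E" for ws q
    using that
  proof (induction ws arbitrary: q)
    case (Cons g ws)
    then show ?case
      using gen_act_tails by (auto simp: bind_eq_Some_conv)
  qed (use p(1) in simp)
  have Q_tails: "Q \<subseteq> tails"
    using b(1) word_tails by (auto simp: Q_def nonunital_free_iff)
  let ?ind = "\<lambda>q0 q. if q = q0 then 1 else 0 :: 'k"
  \<comment> \<open>Expanding \<open>f\<close> on \<open>Q\<close> in indicator functions exhibits
    the coefficients of \<open>b\<close> acting on \<open>p\<close>; one of them is nonzero.\<close>
  have "transpose_act E b f p = transpose_act E b (\<lambda>q. \<Sum>q0\<in>Q. ?ind q0 q * f q0) p"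
  proof (rule transpose_act_cong)
    fix w q assume "w \<in> Poly_Mapping.keys b" "word_act E (letters w) p = Some q"
    then have "q \<in> Q"
      by (auto simp: Q_def)
    have "(\<Sum>q0\<in>Q. ?ind q0 q * f q0) = (\<Sum>q0\<in>Q. if q = q0 then f q0 else 0)"
      by (rule sum.cong) auto
    also have "\<dots> = f q"
      using \<open>q \<in> Q\<close> Q by simp
    finally show "f q = (\<Sum>q0\<in>Q. ?ind q0 q * f q0)"
      by simp
  qed
  also have "\<dots> = (\<Sum>q0\<in>Q. transpose_act E b (?ind q0) p * f q0)"
    by (simp only: transpose_act_fun_sum transpose_act_scale)
  finally have "\<exists>q0\<in>Q. transpose_act E b (?ind q0) p \<noteq> 0"
    using p(2) by (metis (no_types, lifting) mult_zero_left sum.neutral)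
  then obtain q0 where q0: "q0 \<in> Q" "transpose_act E b (?ind q0) p \<noteq> 0"
    by blast
  obtain ws where ws: "ws \<noteq> []" "set ws \<subseteq> lpa_gens E" "word_act E ws q0 = Some p0"
    "\<forall>q\<in>Q. q \<noteq> q0 \<longrightarrow> word_act E ws q = None"
    using separating_word[OF Q subsetD[OF Q_tails q0(1)] p0(1)] .
  have y: "mon ws \<in> free0"
    using ws by (intro nonunital_free_intros(8))
  have "transpose_act E (a * (mon ws * b)) f0 p = transpose_act E b (transpose_act E (mon ws) \<psi>) p"
    by (simp add: transpose_act_mult \<psi>_def)
  also have "\<dots> = transpose_act E b (\<lambda>q. ?ind q0 q * \<psi> p0) p"
  proof (rule transpose_act_cong)
    fix w q assume "w \<in> Poly_Mapping.keys b" "word_act E (letters w) p = Some q"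
    then have "q \<in> Q"
      by (auto simp: Q_def)
    then show "transpose_act E (mon ws) \<psi> q = ?ind q0 q * \<psi> p0"
      using ws by (auto simp: transpose_act_mon)
  qed
  also have "\<dots> = transpose_act E b (?ind q0) p * \<psi> p0"
    by (rule transpose_act_scale)
  also have "\<dots> \<noteq> 0"
    using q0(2) p0(2) by (simp add: \<psi>_def)
  finally have "a * (mon ws * b) \<notin> annihilator"
    using p(1) by (auto simp: annihilator_def)
  then show ?thesis
    using that y by blast
qed

lemma prime_annihilator: "prime_two_sided_ideal (cl ` annihilator) L"
  unfolding prime_two_sided_ideal_def
proof (intro conjI allI impI)
  note iff = cl_mem_image_iff[OF annihilator_lpa_ideal]
  show "two_sided_ideal (cl ` annihilator) L"
    by (rule image_two_sided_ideal[OF annihilator_lpa_ideal])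
  have "cl (vx v) \<in> carrier L"
    using v_verts by (intro cl_carrier nonunital_free_intros(7)) simp
  moreover have "cl (vx v) \<notin> cl ` annihilator"
    using v_not_annihilates unfolding iff .
  ultimately show "cl ` annihilator \<noteq> carrier L"
    by blast
  fix A B
  assume A: "two_sided_ideal A L" and B: "two_sided_ideal B L"
    and AB: "ideal_prod L A B \<subseteq> cl ` annihilator"
  show "A \<subseteq> cl ` annihilator \<or> B \<subseteq> cl ` annihilator"
  proof (rule ccontr)
    assume "\<not> ?thesis"
    then obtain X Y where X: "X \<in> A" "X \<notin> cl ` annihilator" and Y: "Y \<in> B" "Y \<notin> cl ` annihilator"
      by blast
    have "A \<subseteq> carrier L" "B \<subseteq> carrier L"
      using A B by (simp_all add: two_sided_ideal_def additive_subgroup.a_subset)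
    then obtain a b where a: "a \<in> free0" "X = cl a" and b: "b \<in> free0" "Y = cl b"
      using X(1) Y(1) unfolding carrier_L by blast
    have "a \<notin> annihilator" "b \<notin> annihilator"
      using X(2) Y(2) a b by blast+
    then obtain y where y: "y \<in> free0" "a * (y * b) \<notin> annihilator"
      using annihilator_prime_free a(1) b(1) by blast
    have "cl y \<otimes>\<^bsub>L\<^esub> cl b \<in> B"
      using B Y(1) b(2) cl_carrier[OF y(1)] by (simp add: two_sided_ideal_def)
    then have "cl (y * b) \<in> B"
      by (simp only: mult_L[OF y(1) b(1)])
    then have "cl a \<otimes>\<^bsub>L\<^esub> cl (y * b) \<in> ideal_prod L A B"
      using X(1) a(2) by (intro ideal_prod.prod) simp_all
    moreover have "y * b \<in> free0"
      using y(1) b(1) by (intro nonunital_free_intros(5) nonunital_imp_unital)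
    ultimately have "cl (a * (y * b)) \<in> cl ` annihilator"
      using AB by (auto simp only: mult_L[OF a(1)])
    then show False
      using y(2) unfolding iff by blast
  qed
qed

text \<open>\<open>path c\<close> has positive degree, so the component of degree 0 of
  \<open>path c - vx v\<close> is \<open>- vx v\<close>, which does not annihilate.\<close>

lemma annihilator_not_graded: "\<not> graded_ideal (lpa_component K E) (cl ` annihilator) L"
proof
  assume graded: "graded_ideal (lpa_component K E) (cl ` annihilator) L"
  interpret A: lpa_ideal E annihilator
    by (rule annihilator_lpa_ideal)
  have pre: "x \<in> preimage (cl ` annihilator) \<longleftrightarrow> x \<in> annihilator" for x
    using cl_mem_image_iff[OF annihilator_lpa_ideal] A.subset by (auto simp: preimage_def)
  have "hcomp 0 (path c - vx v) \<in> annihilator"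
    using graded_ideal_hcomp_mem[OF graded] c_minus_v_annihilates unfolding pre by blast
  moreover have "hcomp 0 (path c :: (('v, 'e) lpa_gen, 'k) free_poly) = 0"
    using c_ne by (subst hcomp_homogeneous[OF homogeneous_path]) simp
  moreover have "hcomp 0 (vx v :: (('v, 'e) lpa_gen, 'k) free_poly) = vx v"
    by (subst hcomp_homogeneous[OF homogeneous_gen]) simp
  ultimately have "- vx v \<in> annihilator"
    by (simp add: hcomp_diff)
  then show False
    using A.uminus_mem[of "- vx v"] v_not_annihilates by simp
qed

end

theorem corollary3p11:
  fixes E :: "('v, 'e) pre_digraph" and K :: "'k::field itself"
  assumes "wf_digraph E"
  shows "condition_K E \<longleftrightarrow>
    (\<forall>P. prime_two_sided_ideal P (leavitt_path_algebra K E) \<longrightarrow>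
         graded_ideal (lpa_component K E) P (leavitt_path_algebra K E))"
proof
  interpret leavitt E K
    using assms by (rule leavitt.intro)
  {
    assume "condition_K E"
    then show "\<forall>P. prime_two_sided_ideal P L \<longrightarrow> graded_ideal (lpa_component K E) P L"
      using condition_K_imp_graded by (simp add: prime_two_sided_ideal_def)
  next
    assume all: "\<forall>P. prime_two_sided_ideal P L \<longrightarrow> graded_ideal (lpa_component K E) P L"
    show "condition_K E"
    proof (rule ccontr)
      assume "\<not> condition_K E"
      then obtain v c where "closed_simple_path E v c" "\<And>p. closed_simple_path E v p \<Longrightarrow> p = c"
        unfolding condition_K_def by blast
      then interpret unique_closed_path E K v c
        by unfold_locales
      show False
        using all prime_annihilator annihilator_not_graded by blast
    qed
  }
qed

end
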